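(* For any $r\in[2,\infty)$ there exists a finitely generated LEF group $\Gamma^{(r)}$ such that: (i) there exists $C_r>0$ such that $\mathcal{L}_{\Gamma^{(r)}}(n)\preceq \exp\Big(\exp\big(C_r(\log n)^r\big)\Big)$; (ii) for any $2\leq r'<r$ and for all $C>0$, it is not the case that $\mathcal{L}_{\Gamma^{(r)}}(n)\preceq\exp\Big(\exp\big(C(\log n)^{r'}\big)\Big)$.
   Context: $\mathbb{N}=\{1,2,3,\dots\}$. LEF growth. For groups $\Gamma,\Delta$ and $F\subseteq\Gamma$, a local embedding of $F$ into $\Delta$ is an injective map $\phi:F\to\Delta$ such that $\phi(gh)=\phi(g)\phi(h)$ whenever $g,h,gh\in F$. $\Gamma$ is LEF (locally embeddable into finite groups) if every finite subset of $\Gamma$ has a local embedding into some finite group. If $S$ is a finite generating set of the LEF group $\Gamma$ and $B_S(n)$ is the set of elements of word length at most $n$ with respect to $S$, then $\mathcal{L}_\Gamma^S(n)$ is the minimal order of a finite group $Q$ admitting a local embedding $B_S(n)\to Q$. $\mathcal{L}_\Gamma$ denotes $\mathcal{L}_\Gamma^S$ for any finite generating set $S$; the statement does not depend on $S$. Comparison. For nondecreasing functions $F_1,F_2$, write $F_1\preceq F_2$ if there is a constant $C>0$ (which may be taken to be a positive integer) such that $F_1(n)\leq F_2(Cn)$ for all $n\in\mathbb{N}$. *)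

theory Defs
  imports Complex_Main "HOL-Algebra.Generated_Groups"
begin

definition finite_generating_set :: "('a, 'm) monoid_scheme \<Rightarrow> 'a set \<Rightarrow> bool" where
  "finite_generating_set G S \<longleftrightarrow>
     finite S \<and> S \<subseteq> carrier G \<and> generate G S = carrier G"

definition finitely_generated :: "('a, 'm) monoid_scheme \<Rightarrow> bool" where
  "finitely_generated G \<longleftrightarrow> (\<exists>S. finite_generating_set G S)"

text \<open>Letters are taken from \<open>S\<close> and from the inverses of its elements; \<open>S\<close> itself is not
  assumed to be closed under inverses. The word length is meaningful for elements of the
  subgroup generated by \<open>S\<close> only.\<close>

definition word_length :: "('a, 'm) monoid_scheme \<Rightarrow> 'a set \<Rightarrow> 'a \<Rightarrow> nat" where
  "word_length G S g =
     (LEAST k. \<exists>ws. length ws = k \<and> set ws \<subseteq> S \<union> m_inv G ` S \<and>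
                    foldr (\<lambda>x y. x \<otimes>\<^bsub>G\<^esub> y) ws \<one>\<^bsub>G\<^esub> = g)"

definition word_ball :: "('a, 'm) monoid_scheme \<Rightarrow> 'a set \<Rightarrow> nat \<Rightarrow> 'a set" where
  "word_ball G S n = {g \<in> generate G S. word_length G S g \<le> n}"

definition local_embedding ::
    "('a, 'm) monoid_scheme \<Rightarrow> ('b, 'n) monoid_scheme \<Rightarrow> 'a set \<Rightarrow> ('a \<Rightarrow> 'b) \<Rightarrow> bool" where
  "local_embedding G H F \<phi> \<longleftrightarrow>
     F \<subseteq> carrier G \<and> \<phi> ` F \<subseteq> carrier H \<and> inj_on \<phi> F \<and>
     (\<forall>g\<in>F. \<forall>h\<in>F. g \<otimes>\<^bsub>G\<^esub> h \<in> F \<longrightarrow> \<phi> (g \<otimes>\<^bsub>G\<^esub> h) = \<phi> g \<otimes>\<^bsub>H\<^esub> \<phi> h)"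

text \<open>Quantification over all finite groups is rendered as quantification over the finite groups
  with carrier a set of natural numbers: every finite group is isomorphic to one of these.\<close>

definition LEF :: "('a, 'm) monoid_scheme \<Rightarrow> bool" where
  "LEF G \<longleftrightarrow>
     (\<forall>F. finite F \<and> F \<subseteq> carrier G \<longrightarrow>
        (\<exists>(Q :: nat monoid) \<phi>. group Q \<and> finite (carrier Q) \<and> local_embedding G Q F \<phi>))"

definition LEF_growth :: "('a, 'm) monoid_scheme \<Rightarrow> 'a set \<Rightarrow> nat \<Rightarrow> nat" where
  "LEF_growth G S n =
     (LEAST q. \<exists>(Q :: nat monoid) \<phi>. group Q \<and> finite (carrier Q) \<and> order Q = q \<and>
                 local_embedding G Q (word_ball G S n) \<phi>)"

text \<open>Comparison of nondecreasing functions on the positive integers; values at \<open>0\<close> are ignored.\<close>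

definition growth_le :: "(nat \<Rightarrow> real) \<Rightarrow> (nat \<Rightarrow> real) \<Rightarrow> bool" (infix "\<preceq>" 50) where
  "F1 \<preceq> F2 \<longleftrightarrow> (\<exists>C::nat. C > 0 \<and> (\<forall>n\<ge>1. F1 n \<le> F2 (C * n)))"

end

theory Submission
  imports Defs "HOL-Algebra.Elementary_Groups" "HOL-Algebra.Sym_Groups"
    "HOL-Library.Countable_Set" "HOL-Real_Asymp.Real_Asymp"
begin

text \<open>
  Let \<open>H\<close> be the symmetric group on three points and \<open>L\<close> the wreath product of \<open>H\<close> by the integers.
  Fix a set \<open>D\<close> of natural numbers having about \<open>(log n)\<^sup>r\<close> elements below \<open>n\<close>, and let \<open>X\<close> be the
  set of cosets in \<open>L\<close> of the lamp configurations supported off \<open>D\<close>. The group sought is a finitely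
  generated subgroup of the permutational wreath product of \<open>H\<close> by \<open>L\<close> over \<open>X\<close>.

  Switching lamps at positions in \<open>D\<close> below \<open>n\<close> reaches \<open>2 ^ card (D \<inter> {0..<n})\<close> points of \<open>X\<close> in
  \<open>O(n)\<close> steps. Copies of \<open>H\<close> over distinct points commute and \<open>H\<close> is not abelian. These relations
  are visible in a ball of radius \<open>O(n)\<close>, so they hold in every finite group \<open>Q\<close> into which that
  ball embeds locally; there they yield a strictly descending chain of centralizers, whence
  \<open>order Q \<ge> 2 ^ 2 ^ card (D \<inter> {0..<n})\<close>.

  Conversely, replacing the integers by the integers modulo \<open>8 n + 1\<close> and \<open>D\<close> by \<open>D \<inter> {0..4 n}\<close>
  gives a finite wreath product into which the ball of radius \<open>n\<close> embeds locally.
\<close>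

section \<open>Word balls and local embeddings\<close>

text \<open>Frees all later arguments from the \<open>LEAST\<close> in \<open>word_length\<close>.
  Every element of \<open>generate G S\<close> is spelled by some word, since spellings concatenate,
  so the minimum is attained.\<close>

lemma (in group) word_ball_iff:
  assumes "S \<subseteq> carrier G"
  shows "g \<in> word_ball G S n \<longleftrightarrow>
    (\<exists>ws. length ws \<le> n \<and> set ws \<subseteq> S \<union> m_inv G ` S \<and> foldr (\<lambda>x y. x \<otimes> y) ws \<one> = g)"
    (is "_ \<longleftrightarrow> (\<exists>ws. ?P ws)")
proof
  have foldr_generate: "foldr (\<lambda>x y. x \<otimes> y) ws \<one> \<in> generate G S" if "set ws \<subseteq> S \<union> m_inv G ` S" for ws
    using that by (induction ws) (auto intro: generate.intros)
  have foldr_mult: "foldr (\<lambda>x y. x \<otimes> y) (us @ vs) \<one> =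
      foldr (\<lambda>x y. x \<otimes> y) us \<one> \<otimes> foldr (\<lambda>x y. x \<otimes> y) vs \<one>"
    if "set us \<subseteq> S \<union> m_inv G ` S" "set vs \<subseteq> S \<union> m_inv G ` S" for us vs
    using that(1)
  proof (induction us)
    case Nil
    then show ?case
      using generate_in_carrier[OF assms foldr_generate[OF that(2)]] by simp
  next
    case (Cons a us)
    then have "a \<in> carrier G"
      using assms by auto
    with Cons show ?case
      using generate_in_carrier[OF assms foldr_generate[OF that(2)]]
        generate_in_carrier[OF assms foldr_generate[of us]] by (simp add: m_assoc)
  qed
  have word: "\<exists>ws. set ws \<subseteq> S \<union> m_inv G ` S \<and> foldr (\<lambda>x y. x \<otimes> y) ws \<one> = g"
    if "g \<in> generate G S" for g
    using that
  proof induction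
    case one
    show ?case by (rule exI[of _ "[]"]) simp
  next
    case (incl h)
    then show ?case using assms by (intro exI[of _ "[h]"]) auto
  next
    case (inv h)
    then show ?case using assms by (intro exI[of _ "[inv h]"]) auto
  next
    case (eng h1 h2)
    then obtain us vs where *: "set us \<subseteq> S \<union> m_inv G ` S" "foldr (\<lambda>x y. x \<otimes> y) us \<one> = h1"
      "set vs \<subseteq> S \<union> m_inv G ` S" "foldr (\<lambda>x y. x \<otimes> y) vs \<one> = h2"
      by blast
    then show ?case
      using foldr_mult[OF *(1,3)] unfolding *(2,4) by (intro exI[of _ "us @ vs"] conjI) auto
  qed
  {
    assume g: "g \<in> word_ball G S n"
    then have "\<exists>k ws. length ws = k \<and> set ws \<subseteq> S \<union> m_inv G ` S \<and> foldr (\<lambda>x y. x \<otimes> y) ws \<one> = g"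
      using word unfolding word_ball_def by blast
    from LeastI_ex[OF this] obtain ws where "length ws = word_length G S g"
      "set ws \<subseteq> S \<union> m_inv G ` S" "foldr (\<lambda>x y. x \<otimes> y) ws \<one> = g"
      unfolding word_length_def by blast
    moreover have "word_length G S g \<le> n"
      using g by (simp add: word_ball_def)
    ultimately show "\<exists>ws. ?P ws"
      by (intro exI[of _ ws]) simp
  next
    assume "\<exists>ws. ?P ws"
    then obtain ws where ws: "?P ws" by blast
    then have "word_length G S g \<le> length ws"
      unfolding word_length_def by (intro Least_le) blast
    moreover have "g \<in> generate G S"
      using foldr_generate ws by blast
    ultimately show "g \<in> word_ball G S n"
      using ws unfolding word_ball_def by simp
  }
qed

lemma (in group) word_ball_subset_carrier:
  assumes "S \<subseteq> carrier G"
  shows "word_ball G S n \<subseteq> carrier G"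
  using generate_in_carrier[OF assms] by (auto simp: word_ball_def)

lemma (in group) generate_in_word_ball:
  assumes "g \<in> generate G S"
  obtains n where "g \<in> word_ball G S n"
  using assms by (auto simp: word_ball_def)

lemma word_ball_mono: "m \<le> n \<Longrightarrow> word_ball G S m \<subseteq> word_ball G S n"
  by (auto simp: word_ball_def)

text \<open>The induction principle for balls: a filtration compatible with products captures all
  balls once it captures the letters at level 1. It serves for inverses, images under homomorphisms,
  change of generators and the explicit sets \<open>dw_ball\<close>.\<close>

lemma (in group) word_ball_minimal:
  assumes "S \<subseteq> carrier G"
    and one: "\<And>n. \<one> \<in> E n"
    and gen: "\<And>s. s \<in> S \<Longrightarrow> s \<in> E 1" "\<And>s. s \<in> S \<Longrightarrow> inv s \<in> E 1"
    and E: "\<And>m. E m \<subseteq> carrier G"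
    and mult: "\<And>m n g h. g \<in> E m \<Longrightarrow> h \<in> E n \<Longrightarrow> g \<otimes> h \<in> E (m + n)"
  shows "word_ball G S n \<subseteq> E n"
proof
  fix g assume "g \<in> word_ball G S n"
  then obtain ws where ws: "length ws \<le> n" "set ws \<subseteq> S \<union> m_inv G ` S"
    "foldr (\<lambda>x y. x \<otimes> y) ws \<one> = g"
    unfolding word_ball_iff[OF assms(1)] by blast
  have "foldr (\<lambda>x y. x \<otimes> y) ws \<one> \<in> E (length ws)"
    using ws(2)
  proof (induction ws)
    case (Cons a ws)
    then have "a \<in> E 1" using gen by auto
    from mult[OF this Cons.IH] Cons.prems show ?case by simp
  qed (simp add: one)
  then have "g \<in> E (length ws)" using ws by simp
  \<comment> \<open>Padding with the identity, which lies at every level, lifts a short word to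
    level \<open>n\<close>; this replaces monotonicity of \<open>E\<close>.\<close>
  from mult[OF this one, of "n - length ws"] show "g \<in> E n"
    using ws(1) E \<open>g \<in> E (length ws)\<close> by (metis le_add_diff_inverse r_one subsetD)
qed

lemma (in group) one_word_ball: "S \<subseteq> carrier G \<Longrightarrow> \<one> \<in> word_ball G S n"
  unfolding word_ball_iff by (rule exI[of _ "[]"]) simp

lemma (in group) gen_word_ball: "S \<subseteq> carrier G \<Longrightarrow> s \<in> S \<Longrightarrow> s \<in> word_ball G S 1"
  unfolding word_ball_iff by (rule exI[of _ "[s]"]) auto

lemma (in group) inv_gen_word_ball: "S \<subseteq> carrier G \<Longrightarrow> s \<in> S \<Longrightarrow> inv s \<in> word_ball G S 1"
  unfolding word_ball_iff by (rule exI[of _ "[inv s]"]) auto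

lemma (in group) word_ball_mult:
  assumes "S \<subseteq> carrier G" "g \<in> word_ball G S m" "h \<in> word_ball G S n"
  shows "g \<otimes> h \<in> word_ball G S (m + n)"
proof -
  obtain us where us: "length us \<le> m" "set us \<subseteq> S \<union> m_inv G ` S"
    "foldr (\<lambda>x y. x \<otimes> y) us \<one> = g"
    using assms unfolding word_ball_iff[OF assms(1)] by blast
  obtain vs where vs: "length vs \<le> n" "set vs \<subseteq> S \<union> m_inv G ` S"
    "foldr (\<lambda>x y. x \<otimes> y) vs \<one> = h"
    using assms unfolding word_ball_iff[OF assms(1)] by blast
  have h: "h \<in> carrier G" using assms word_ball_subset_carrier by blast
  have *: "foldr (\<lambda>x y. x \<otimes> y) us \<one> \<in> carrier G \<and>
      foldr (\<lambda>x y. x \<otimes> y) us h = foldr (\<lambda>x y. x \<otimes> y) us \<one> \<otimes> h"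
    using us(2)
  proof (induction us)
    case (Cons a us)
    then have "a \<in> carrier G" using assms(1) by auto
    with Cons show ?case using h by (auto simp: m_assoc)
  qed (simp add: h)
  show ?thesis
    unfolding word_ball_iff[OF assms(1)]
  proof (intro exI[of _ "us @ vs"] conjI)
    show "foldr (\<lambda>x y. x \<otimes> y) (us @ vs) \<one> = g \<otimes> h"
      using * unfolding us(3) by (simp add: vs(3))
  qed (use us vs in auto)
qed

lemma (in group) word_ball_inv:
  assumes S: "S \<subseteq> carrier G" and "g \<in> word_ball G S n"
  shows "inv g \<in> word_ball G S n"
proof -
  have "word_ball G S n \<subseteq> {g \<in> carrier G. inv g \<in> word_ball G S n}"
  proof (rule word_ball_minimal[OF S, where E = "\<lambda>n. {g \<in> carrier G. inv g \<in> word_ball G S n}"])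
    fix m n g h assume "g \<in> {g \<in> carrier G. inv g \<in> word_ball G S m}"
      "h \<in> {g \<in> carrier G. inv g \<in> word_ball G S n}"
    then show "g \<otimes> h \<in> {g \<in> carrier G. inv g \<in> word_ball G S (m + n)}"
      using word_ball_mult[OF S, of "inv h" n "inv g" m] by (simp add: inv_mult_group add.commute)
  qed (use S gen_word_ball[OF S] inv_gen_word_ball[OF S] one_word_ball[OF S] in auto)
  with assms(2) show ?thesis by blast
qed

text \<open>Transfers balls between the double wreath product and the copy on the naturals of its
  finitely generated subgroup.\<close>

lemma (in group_hom) word_ball_image:
  assumes S: "S \<subseteq> carrier G"
  shows "h ` word_ball G S n = word_ball H (h ` S) n"
proof
  have hS: "h ` S \<subseteq> carrier H" using S by auto
  have "word_ball G S n \<subseteq> {g \<in> carrier G. h g \<in> word_ball H (h ` S) n}"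
  proof (rule G.word_ball_minimal[OF S, where E = "\<lambda>n. {g \<in> carrier G. h g \<in> word_ball H (h ` S) n}"])
    fix s assume "s \<in> S"
    then show "inv s \<in> {g \<in> carrier G. h g \<in> word_ball H (h ` S) 1}"
      using S H.inv_gen_word_ball[OF hS, of "h s"] by auto
  qed (use S H.gen_word_ball[OF hS] H.one_word_ball[OF hS] H.word_ball_mult[OF hS] in auto)
  then show "h ` word_ball G S n \<subseteq> word_ball H (h ` S) n" by blast
  show "word_ball H (h ` S) n \<subseteq> h ` word_ball G S n"
  proof (rule H.word_ball_minimal[OF hS, where E = "\<lambda>n. h ` word_ball G S n"])
    show "\<one>\<^bsub>H\<^esub> \<in> h ` word_ball G S n" for n
      using G.one_word_ball[OF S] hom_one by (metis imageI)
    show "s \<in> h ` word_ball G S 1" if "s \<in> h ` S" for s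
      using G.gen_word_ball[OF S] that by auto
    show "inv\<^bsub>H\<^esub> s \<in> h ` word_ball G S 1" if s: "s \<in> h ` S" for s
    proof -
      obtain a where a: "a \<in> S" "s = h a" using s by blast
      then have "inv\<^bsub>H\<^esub> s = h (inv a)" using S by auto
      then show ?thesis using G.inv_gen_word_ball[OF S a(1)] by simp
    qed
    show "h ` word_ball G S m \<subseteq> carrier H" for m
      using G.word_ball_subset_carrier[OF S] by (blast intro: hom_closed)
    fix m n g k assume "g \<in> h ` word_ball G S m" "k \<in> h ` word_ball G S n"
    then obtain a b where *: "g = h a" "k = h b" "a \<in> word_ball G S m" "b \<in> word_ball G S n" by blast
    then have "g \<otimes>\<^bsub>H\<^esub> k = h (a \<otimes> b)"
      using G.word_ball_subset_carrier[OF S] by (metis hom_mult subsetD)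
    then show "g \<otimes>\<^bsub>H\<^esub> k \<in> h ` word_ball G S (m + n)"
      using G.word_ball_mult[OF S *(3,4)] by simp
  qed
qed

text \<open>Changing generators only rescales the radius, and \<open>growth_le\<close> absorbs a
  rescaling; hence bounds proved for one generating set carry over to all.\<close>

lemma (in group) word_ball_change:
  assumes S: "finite_generating_set G S" and T: "finite_generating_set G T"
  obtains K :: nat where "K > 0" "\<And>n. word_ball G S n \<subseteq> word_ball G T (K * n)"
proof -
  have Sc: "S \<subseteq> carrier G" and Tc: "T \<subseteq> carrier G" and "finite S"
    using S T by (auto simp: finite_generating_set_def)
  have "\<exists>k. s \<in> word_ball G T k" if "s \<in> S" for s
    using that Sc T by (metis finite_generating_set_def generate_in_word_ball subsetD)
  then obtain k where k: "\<And>s. s \<in> S \<Longrightarrow> s \<in> word_ball G T (k s)" by metis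
  \<comment> \<open>The sum dominates every \<open>k s\<close>, and \<open>Suc\<close> keeps
    \<open>K\<close> positive even when all lengths vanish.\<close>
  define K where "K = Suc (\<Sum>s\<in>S. k s)"
  have K: "s \<in> word_ball G T K" if "s \<in> S" for s
  proof -
    have "k s \<le> (\<Sum>s\<in>S. k s)" using \<open>finite S\<close> that by (simp add: member_le_sum)
    then show ?thesis using k[OF that] word_ball_mono[of "k s" K G T] by (auto simp: K_def)
  qed
  have "word_ball G S n \<subseteq> word_ball G T (K * n)" for n
  proof (rule word_ball_minimal[OF Sc, where E = "\<lambda>n. word_ball G T (K * n)"])
    show "g \<otimes> h \<in> word_ball G T (K * (m + n))"
      if "g \<in> word_ball G T (K * m)" "h \<in> word_ball G T (K * n)" for m n g h
      using word_ball_mult[OF Tc that] by (simp add: distrib_left)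
  qed (use K one_word_ball[OF Tc] word_ball_inv[OF Tc] word_ball_subset_carrier[OF Tc] in auto)
  then show thesis using that[of K] by (simp add: K_def)
qed

section \<open>Local embeddings\<close>

lemma local_embedding_subset:
  "local_embedding G H F \<phi> \<Longrightarrow> F' \<subseteq> F \<Longrightarrow> local_embedding G H F' \<phi>"
  unfolding local_embedding_def by (meson image_mono inj_on_subset order_trans subsetD)

lemma local_embedding_mult:
  "local_embedding G H F \<phi> \<Longrightarrow> g \<in> F \<Longrightarrow> h \<in> F \<Longrightarrow> g \<otimes>\<^bsub>G\<^esub> h \<in> F \<Longrightarrow>
    \<phi> (g \<otimes>\<^bsub>G\<^esub> h) = \<phi> g \<otimes>\<^bsub>H\<^esub> \<phi> h"
  by (simp add: local_embedding_def)

lemma local_embedding_comp: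
  assumes "local_embedding G H F \<phi>" "local_embedding H K F' \<psi>" "\<phi> ` F \<subseteq> F'"
  shows "local_embedding G K F (\<psi> \<circ> \<phi>)"
proof -
  have *: "\<phi> g \<in> F'" if "g \<in> F" for g using assms(3) that by blast
  have "inj_on (\<psi> \<circ> \<phi>) F"
    using assms unfolding local_embedding_def by (meson comp_inj_on inj_on_subset)
  moreover have "\<psi> (\<phi> (g \<otimes>\<^bsub>G\<^esub> h)) = \<psi> (\<phi> g) \<otimes>\<^bsub>K\<^esub> \<psi> (\<phi> h)"
    if "g \<in> F" "h \<in> F" "g \<otimes>\<^bsub>G\<^esub> h \<in> F" for g h
    using assms(1,2) *[OF that(1)] *[OF that(2)] *[OF that(3)] that
    unfolding local_embedding_def by simp
  moreover have "(\<psi> \<circ> \<phi>) ` F \<subseteq> carrier K"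
    using assms(2) * unfolding local_embedding_def by auto
  ultimately show ?thesis
    using assms(1) unfolding local_embedding_def by simp
qed

lemma local_embedding_hom:
  assumes "\<phi> \<in> hom G H" "inj_on \<phi> (carrier G)" "F \<subseteq> carrier G"
  shows "local_embedding G H F \<phi>"
  using assms unfolding local_embedding_def hom_def
  by (auto intro: inj_on_subset)

text \<open>\<open>LEF\<close>, \<open>LEF_growth\<close> and the theorem quantify over groups on
  the naturals; an enumeration of the carrier moves any countable group there.\<close>

lemma (in group) countable_group_nat_copy:
  assumes "countable (carrier G)"
  obtains N :: "nat monoid" and d
  where "group N" "d \<in> iso N G"
proof -
  define e where "e = to_nat_on (carrier G)"
  define d where "d = from_nat_into (carrier G)"
  have de: "d (e g) = g" if "g \<in> carrier G" for g
    using assms that by (simp add: d_def e_def)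
  define N :: "nat monoid" where
    "N = \<lparr>carrier = e ` carrier G, monoid.mult = \<lambda>a b. e (d a \<otimes> d b), one = e \<one>\<rparr>"
  have "group N"
  proof (rule groupI)
    show "\<exists>y\<in>carrier N. y \<otimes>\<^bsub>N\<^esub> x = \<one>\<^bsub>N\<^esub>" if "x \<in> carrier N" for x
    proof -
      from that obtain g where g: "x = e g" "g \<in> carrier G" by (auto simp: N_def)
      then show ?thesis by (intro bexI[of _ "e (inv g)"]) (auto simp: N_def de)
    qed
  qed (auto simp: N_def de m_assoc)
  moreover have "d \<in> hom N G" by (auto simp: hom_def N_def de)
  moreover have "bij_betw d (carrier N) (carrier G)"
    by (rule bij_betw_byWitness[where f' = e]) (auto simp: N_def de)
  ultimately show thesis using that by (simp add: iso_def)
qed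

lemma (in group) countable_generate:
  assumes "S \<subseteq> carrier G" "countable S"
  shows "countable (generate G S)"
proof (rule countable_subset)
  show "generate G S \<subseteq> (\<lambda>ws. foldr (\<lambda>x y. x \<otimes> y) ws \<one>) ` lists (S \<union> m_inv G ` S)"
  proof
    fix g assume "g \<in> generate G S"
    then obtain n where "g \<in> word_ball G S n" by (rule generate_in_word_ball)
    then show "g \<in> (\<lambda>ws. foldr (\<lambda>x y. x \<otimes> y) ws \<one>) ` lists (S \<union> m_inv G ` S)"
      unfolding word_ball_iff[OF assms(1)] by blast
  qed
  show "countable ((\<lambda>ws. foldr (\<lambda>x y. x \<otimes> y) ws \<one>) ` lists (S \<union> m_inv G ` S))"
    using assms by auto
qed

text \<open>Every further commuting pair properly shrinks the centralizer of the \<open>u x\<close>, at least by a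
  factor \<open>2\<close>.\<close>

lemma (in group) order_ge_of_commuting_pairs:
  assumes fin: "finite (carrier G)" "finite X"
    and tu: "\<And>x. x \<in> X \<Longrightarrow> t x \<in> carrier G" "\<And>x. x \<in> X \<Longrightarrow> u x \<in> carrier G"
    and comm: "\<And>x y. x \<in> X \<Longrightarrow> y \<in> X \<Longrightarrow> t x \<otimes> u y = u y \<otimes> t x \<longleftrightarrow> x \<noteq> y"
  shows "2 ^ card X \<le> order G"
proof -
  define C where "C Y = {g \<in> carrier G. \<forall>y\<in>Y. g \<otimes> u y = u y \<otimes> g}" for Y
  have sub: "subgroup (C Y) G" if "Y \<subseteq> X" for Y
  proof (rule subgroupI)
    show "C Y \<noteq> {}" using that tu by (auto simp: C_def intro!: exI[of _ \<one>])
  next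
    fix a assume a: "a \<in> C Y"
    then have ac: "a \<in> carrier G" by (auto simp: C_def)
    have "inv a \<otimes> u y = u y \<otimes> inv a" if "y \<in> Y" for y
    proof -
      have uc: "u y \<in> carrier G" using \<open>Y \<subseteq> X\<close> that tu by blast
      have "a \<otimes> u y = u y \<otimes> a" using a that by (auto simp: C_def)
      then have "u y = a \<otimes> (u y \<otimes> inv a)"
        using ac uc by (metis inv_closed inv_solve_right m_assoc m_closed)
      then show ?thesis using ac uc by (metis inv_closed inv_solve_left m_closed)
    qed
    with ac show "inv a \<in> C Y" by (auto simp: C_def)
  next
    fix a b assume *: "a \<in> C Y" "b \<in> C Y"
    have "a \<otimes> b \<otimes> u y = u y \<otimes> (a \<otimes> b)" if "y \<in> Y" for y
    proof -
      have uc: "u y \<in> carrier G" using \<open>Y \<subseteq> X\<close> that tu by blast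
      have ab: "a \<in> carrier G" "b \<in> carrier G" "a \<otimes> u y = u y \<otimes> a" "b \<otimes> u y = u y \<otimes> b"
        using * that by (auto simp: C_def)
      have "a \<otimes> b \<otimes> u y = a \<otimes> (u y \<otimes> b)" using ab uc by (simp add: m_assoc)
      also have "\<dots> = (u y \<otimes> a) \<otimes> b" using ab(1,2) uc by (simp add: m_assoc ab(3)[symmetric])
      finally show ?thesis using ab(1,2) uc by (simp add: m_assoc)
    qed
    with * show "a \<otimes> b \<in> C Y" by (auto simp: C_def)
  qed (auto simp: C_def)
  have "Y \<subseteq> X \<longrightarrow> 2 ^ card Y * card (C Y) \<le> order G" if "finite Y" for Y
    using that
  proof (induction Y)
    case empty
    then show ?case by (auto simp: C_def order_def)
  next
    case (insert x Y)
    show ?case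
    proof
      assume Y: "insert x Y \<subseteq> X"
      let ?K = "G\<lparr>carrier := C Y\<rparr>"
      interpret K: group ?K using sub[of Y] Y by (simp add: subgroup_imp_group)
      have CC: "C (insert x Y) \<subseteq> C Y" by (auto simp: C_def)
      have "subgroup (C (insert x Y)) ?K"
        using sub[of "insert x Y"] sub[of Y] CC Y by (simp add: subgroup_incl)
      from K.lagrange[OF this] have eq: "card (rcosets\<^bsub>?K\<^esub> C (insert x Y)) * card (C (insert x Y)) = card (C Y)"
        by (simp add: order_def)
      \<comment> \<open>\<open>t x\<close> commutes with all \<open>u y\<close> for \<open>y\<close>
        in \<open>Y\<close>, as \<open>x\<close> is not in \<open>Y\<close>, but not with
        \<open>u x\<close>. So the new centralizer is strictly smaller, and by Lagrange its index is
        at least 2.\<close>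
      have "t x \<in> C Y" using Y insert.hyps tu comm by (auto simp: C_def)
      moreover have "t x \<notin> C (insert x Y)" using Y comm[of x x] by (auto simp: C_def)
      ultimately have "C (insert x Y) \<subset> C Y" using CC by blast
      moreover have finC: "finite (C Y)" using fin by (auto simp: C_def)
      ultimately have less: "card (C (insert x Y)) < card (C Y)" by (simp add: psubset_card_mono)
      have "2 \<le> card (rcosets\<^bsub>?K\<^esub> C (insert x Y))"
      proof (rule ccontr)
        assume "\<not> ?thesis"
        then have "card (rcosets\<^bsub>?K\<^esub> C (insert x Y)) \<le> 1" by simp
        then have "card (C Y) \<le> 1 * card (C (insert x Y))"
          unfolding eq[symmetric] by (rule mult_le_mono1)
        with less show False by simp
      qed
      then have "2 * card (C (insert x Y)) \<le> card (C Y)"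
        unfolding eq[symmetric] by (rule mult_le_mono1)
      then have "2 ^ card Y * (2 * card (C (insert x Y))) \<le> 2 ^ card Y * card (C Y)"
        by simp
      also have "\<dots> \<le> order G" using insert Y by simp
      finally show "2 ^ card (insert x Y) * card (C (insert x Y)) \<le> order G"
        using insert.hyps by (simp add: mult_ac)
    qed
  qed
  from this[OF fin(2)] have "2 ^ card X * card (C X) \<le> order G" by simp
  moreover have "card (C X) \<ge> 1"
    using fin(1) sub[of X] by (metis One_nat_def Suc_leI card_gt_0_iff finite_subset order_refl
        subgroup.one_closed subgroup.subset empty_iff)
  ultimately show ?thesis
    by (metis le_trans mult.right_neutral mult_le_mono2)
qed

section \<open>Permutational wreath products\<close>

text \<open>Configurations are total functions with the default value one off \<open>P\<close>, so
  that their equality is equality of functions. Supports may be infinite: for infinite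
  \<open>P\<close> the wreath products below are the unrestricted ones.\<close>

definition supported :: "('h, 'm) monoid_scheme \<Rightarrow> 'x set \<Rightarrow> ('x \<Rightarrow> 'h) set" where
  "supported H P = {f. (\<forall>x. f x \<in> carrier H) \<and> (\<forall>x. x \<notin> P \<longrightarrow> f x = \<one>\<^bsub>H\<^esub>)}"

lemma supported_closed: "f \<in> supported H P \<Longrightarrow> f x \<in> carrier H"
  by (simp add: supported_def)

lemma supported_outside: "f \<in> supported H P \<Longrightarrow> x \<notin> P \<Longrightarrow> f x = \<one>\<^bsub>H\<^esub>"
  by (simp add: supported_def)

text \<open>The inverse makes translation of configurations a left action. The test for membership
  in \<open>P\<close> is there because \<open>act\<close> is unconstrained off
  \<open>P\<close>.\<close>

definition wreath ::
    "('h, 'm) monoid_scheme \<Rightarrow> ('g, 'n) monoid_scheme \<Rightarrow> 'x set \<Rightarrow> ('g \<Rightarrow> 'x \<Rightarrow> 'x) \<Rightarrow>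
     (('x \<Rightarrow> 'h) \<times> 'g) monoid" where
  "wreath H G P act =
     \<lparr>carrier = supported H P \<times> carrier G,
      monoid.mult = (\<lambda>(f, g) (f', g').
        (\<lambda>x. if x \<in> P then f x \<otimes>\<^bsub>H\<^esub> f' (act (inv\<^bsub>G\<^esub> g) x) else \<one>\<^bsub>H\<^esub>, g \<otimes>\<^bsub>G\<^esub> g')),
      one = (\<lambda>_. \<one>\<^bsub>H\<^esub>, \<one>\<^bsub>G\<^esub>)\<rparr>"

definition top_elt :: "('h, 'm) monoid_scheme \<Rightarrow> 'g \<Rightarrow> ('x \<Rightarrow> 'h) \<times> 'g" where
  "top_elt H g = (\<lambda>_. \<one>\<^bsub>H\<^esub>, g)"

definition base_elt ::
    "('h, 'm) monoid_scheme \<Rightarrow> ('g, 'n) monoid_scheme \<Rightarrow> 'x \<Rightarrow> 'h \<Rightarrow> ('x \<Rightarrow> 'h) \<times> 'g" where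
  "base_elt H G x h = (\<lambda>y. if y = x then h else \<one>\<^bsub>H\<^esub>, \<one>\<^bsub>G\<^esub>)"

locale wreath_data = H: group H + G: group G
  for H :: "('h, 'm) monoid_scheme" and G :: "('g, 'n) monoid_scheme" +
  fixes P :: "'x set" and act :: "'g \<Rightarrow> 'x \<Rightarrow> 'x"
  assumes act_closed: "\<And>g x. g \<in> carrier G \<Longrightarrow> x \<in> P \<Longrightarrow> act g x \<in> P"
    and act_one: "\<And>x. x \<in> P \<Longrightarrow> act \<one>\<^bsub>G\<^esub> x = x"
    and act_mult: "\<And>g h x. g \<in> carrier G \<Longrightarrow> h \<in> carrier G \<Longrightarrow> x \<in> P \<Longrightarrow>
      act (g \<otimes>\<^bsub>G\<^esub> h) x = act g (act h x)"
begin

abbreviation W where "W \<equiv> wreath H G P act"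

lemma act_inv: "g \<in> carrier G \<Longrightarrow> x \<in> P \<Longrightarrow> act (inv\<^bsub>G\<^esub> g) (act g x) = x"
  "g \<in> carrier G \<Longrightarrow> x \<in> P \<Longrightarrow> act g (act (inv\<^bsub>G\<^esub> g) x) = x"
  by (simp_all add: act_mult[symmetric] act_one)

lemma carrier_W: "carrier W = supported H P \<times> carrier G"
  by (simp add: wreath_def)

lemma one_W: "\<one>\<^bsub>W\<^esub> = (\<lambda>_. \<one>\<^bsub>H\<^esub>, \<one>\<^bsub>G\<^esub>)"
  by (simp add: wreath_def)

lemma mult_W: "(f, g) \<otimes>\<^bsub>W\<^esub> (f', g') =
    (\<lambda>x. if x \<in> P then f x \<otimes>\<^bsub>H\<^esub> f' (act (inv\<^bsub>G\<^esub> g) x) else \<one>\<^bsub>H\<^esub>, g \<otimes>\<^bsub>G\<^esub> g')"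
  by (simp add: wreath_def)

lemma group_W: "group W"
proof (rule groupI)
  fix a b assume "a \<in> carrier W" "b \<in> carrier W"
  then show "a \<otimes>\<^bsub>W\<^esub> b \<in> carrier W"
    by (cases a; cases b) (auto simp: carrier_W mult_W supported_def)
next
  show "\<one>\<^bsub>W\<^esub> \<in> carrier W" by (simp add: carrier_W one_W supported_def)
next
  fix a b c assume *: "a \<in> carrier W" "b \<in> carrier W" "c \<in> carrier W"
  show "a \<otimes>\<^bsub>W\<^esub> b \<otimes>\<^bsub>W\<^esub> c = a \<otimes>\<^bsub>W\<^esub> (b \<otimes>\<^bsub>W\<^esub> c)"
  proof (cases a; cases b; cases c)
    fix f g f' g' f'' g'' assume eq: "a = (f, g)" "b = (f', g')" "c = (f'', g'')"
    then have "g \<in> carrier G" "g' \<in> carrier G" "g'' \<in> carrier G"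
      "\<And>x. f x \<in> carrier H" "\<And>x. f' x \<in> carrier H" "\<And>x. f'' x \<in> carrier H"
      using * by (auto simp: carrier_W supported_def)
    then show ?thesis
      by (auto simp: eq mult_W G.m_assoc H.m_assoc G.inv_mult_group act_mult act_closed)
  qed
next
  fix a assume *: "a \<in> carrier W"
  show "\<one>\<^bsub>W\<^esub> \<otimes>\<^bsub>W\<^esub> a = a"
    using * by (cases a) (auto simp: carrier_W mult_W one_W supported_def act_one)
  obtain f g where a: "a = (f, g)" by (cases a)
  have fg: "g \<in> carrier G" "\<And>x. f x \<in> carrier H" using * by (auto simp: a carrier_W supported_def)
  show "\<exists>y\<in>carrier W. y \<otimes>\<^bsub>W\<^esub> a = \<one>\<^bsub>W\<^esub>"
  proof (rule bexI)
    show "(\<lambda>x. if x \<in> P then inv\<^bsub>H\<^esub> (f (act g x)) else \<one>\<^bsub>H\<^esub>, inv\<^bsub>G\<^esub> g) \<otimes>\<^bsub>W\<^esub> a = \<one>\<^bsub>W\<^esub>"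
      using fg by (auto simp: a mult_W one_W)
  qed (use fg in \<open>auto simp: carrier_W supported_def\<close>)
qed

sublocale W: group W
  by (rule group_W)

lemma top_elt_closed: "g \<in> carrier G \<Longrightarrow> top_elt H g \<in> carrier W"
  by (simp add: top_elt_def carrier_W supported_def)

lemma top_elt_mult: "g \<in> carrier G \<Longrightarrow> top_elt H g \<otimes>\<^bsub>W\<^esub> top_elt H g' = top_elt H (g \<otimes>\<^bsub>G\<^esub> g')"
  by (auto simp: top_elt_def mult_W)

lemma top_elt_inv: "g \<in> carrier G \<Longrightarrow> inv\<^bsub>W\<^esub> (top_elt H g) = top_elt H (inv\<^bsub>G\<^esub> g)"
  by (rule W.inv_equality) (simp_all add: top_elt_mult top_elt_closed, simp add: one_W top_elt_def)

lemma base_elt_closed: "x \<in> P \<Longrightarrow> h \<in> carrier H \<Longrightarrow> base_elt H G x h \<in> carrier W"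
  by (auto simp: base_elt_def carrier_W supported_def)

lemma base_elt_mult:
  "x \<in> P \<Longrightarrow> h \<in> carrier H \<Longrightarrow> k \<in> carrier H \<Longrightarrow>
    base_elt H G x h \<otimes>\<^bsub>W\<^esub> base_elt H G x k = base_elt H G x (h \<otimes>\<^bsub>H\<^esub> k)"
  by (auto simp: base_elt_def mult_W act_one)

lemma base_elt_inv:
  "x \<in> P \<Longrightarrow> h \<in> carrier H \<Longrightarrow> inv\<^bsub>W\<^esub> (base_elt H G x h) = base_elt H G x (inv\<^bsub>H\<^esub> h)"
  by (rule W.inv_equality) (simp_all add: base_elt_mult base_elt_closed, simp add: one_W base_elt_def)

lemma base_elt_commute:
  "x \<in> P \<Longrightarrow> y \<in> P \<Longrightarrow> h \<in> carrier H \<Longrightarrow> k \<in> carrier H \<Longrightarrow> x \<noteq> y \<Longrightarrow>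
    base_elt H G x h \<otimes>\<^bsub>W\<^esub> base_elt H G y k = base_elt H G y k \<otimes>\<^bsub>W\<^esub> base_elt H G x h"
  by (auto simp: base_elt_def mult_W act_one fun_eq_iff)

text \<open>Conjugation by the top group moves the copy of \<open>H\<close> over a point along its
  orbit. One copy among the generators thus yields a copy over every point that short elements
  reach.\<close>

lemma base_elt_conj:
  assumes "g \<in> carrier G" "x \<in> P" "h \<in> carrier H"
  shows "top_elt H g \<otimes>\<^bsub>W\<^esub> base_elt H G x h \<otimes>\<^bsub>W\<^esub> inv\<^bsub>W\<^esub> (top_elt H g) = base_elt H G (act g x) h"
proof -
  have "act (inv\<^bsub>G\<^esub> g) y = x \<longleftrightarrow> y = act g x" if "y \<in> P" for y
    using assms that act_inv by metis
  then show ?thesis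
    using assms act_closed
    by (auto simp: top_elt_inv) (auto simp: top_elt_def base_elt_def mult_W fun_eq_iff)
qed

end

section \<open>Local embeddings between wreath products\<close>

definition push_forward ::
    "('h, 'm) monoid_scheme \<Rightarrow> 'x set \<Rightarrow> ('x \<Rightarrow> 'y) \<Rightarrow> ('x \<Rightarrow> 'h) \<Rightarrow> 'y \<Rightarrow> 'h" where
  "push_forward H B i f y = (if y \<in> i ` B then f (inv_into B i y) else \<one>\<^bsub>H\<^esub>)"

lemma push_forward_apply:
  "inj_on i B \<Longrightarrow> x \<in> B \<Longrightarrow> push_forward H B i f (i x) = f x"
  by (simp add: push_forward_def)

lemma push_forward_outside: "y \<notin> i ` B \<Longrightarrow> push_forward H B i f y = \<one>\<^bsub>H\<^esub>"
  by (simp add: push_forward_def)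

text \<open>Equivariance is demanded only where \<open>x\<close> and \<open>act g x\<close> both lie
  in \<open>B\<close>. This suffices since a product that is again supported on \<open>B\<close>
  cannot have moved a nontrivial value of the second factor out of \<open>B\<close>.\<close>

lemma local_embedding_wreath:
  assumes "wreath_data H G P act" "wreath_data H G' P' act'"
    and \<psi>: "local_embedding G G' F \<psi>"
    and B: "B \<subseteq> P" "i ` B \<subseteq> P'" "inj_on i B"
    and equiv: "\<And>g x. g \<in> F \<Longrightarrow> x \<in> B \<Longrightarrow> act g x \<in> B \<Longrightarrow> i (act g x) = act' (\<psi> g) (i x)"
  shows "local_embedding (wreath H G P act) (wreath H G' P' act') (supported H B \<times> F)
    (\<lambda>(f, g). (push_forward H B i f, \<psi> g))"
proof -
  interpret A: wreath_data H G P act by fact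
  interpret A': wreath_data H G' P' act' by fact
  have F: "F \<subseteq> carrier G" and \<psi>F: "\<And>g. g \<in> F \<Longrightarrow> \<psi> g \<in> carrier G'" and \<psi>inj: "inj_on \<psi> F"
    using \<psi> by (auto simp: local_embedding_def)
  note app = push_forward_apply[OF B(3)]
  have inj: "inj_on (\<lambda>(f, g). (push_forward H B i f, \<psi> g)) (supported H B \<times> F)"
  proof (rule inj_onI, clarify)
    fix f g f' g' assume *: "f \<in> supported H B" "f' \<in> supported H B" "g \<in> F" "g' \<in> F"
      "push_forward H B i f = push_forward H B i f'" "\<psi> g = \<psi> g'"
    have "f x = f' x" for x
      using *(1,2) app[of x H f] app[of x H f'] unfolding *(5)
      by (cases "x \<in> B") (auto simp: supported_def)
    then show "f = f' \<and> g = g'" using * \<psi>inj by (auto dest: inj_onD)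
  qed
  have hom: "push_forward H B i (\<lambda>x. if x \<in> P then f x \<otimes>\<^bsub>H\<^esub> f' (act (inv\<^bsub>G\<^esub> g) x) else \<one>\<^bsub>H\<^esub>) y =
      (if y \<in> P' then push_forward H B i f y \<otimes>\<^bsub>H\<^esub> push_forward H B i f' (act' (inv\<^bsub>G'\<^esub> (\<psi> g)) y)
       else \<one>\<^bsub>H\<^esub>)"
    if f: "f \<in> supported H B" "f' \<in> supported H B" and g: "g \<in> F"
      and fg: "(\<lambda>x. if x \<in> P then f x \<otimes>\<^bsub>H\<^esub> f' (act (inv\<^bsub>G\<^esub> g) x) else \<one>\<^bsub>H\<^esub>) \<in> supported H B"
    for f f' g y
  proof -
    have gc: "g \<in> carrier G" "\<psi> g \<in> carrier G'" using F \<psi>F g by auto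
    have fc: "f x \<in> carrier H" "f' x \<in> carrier H" "x \<notin> B \<Longrightarrow> f x = \<one>\<^bsub>H\<^esub>" "x \<notin> B \<Longrightarrow> f' x = \<one>\<^bsub>H\<^esub>" for x
      using f by (auto simp: supported_def)
    \<comment> \<open>If \<open>act g x\<close> were outside \<open>B\<close>, then \<open>f\<close>
      would be one there and could not cancel \<open>f' x\<close>; the product would be nontrivial
      outside \<open>B\<close>, against \<open>fg\<close>.\<close>
    have stay: "act g x \<in> B" if x: "x \<in> B" "f' x \<noteq> \<one>\<^bsub>H\<^esub>" for x
    proof (rule ccontr)
      assume nB: "act g x \<notin> B"
      have xP: "x \<in> P" using x B(1) by blast
      have "(if act g x \<in> P then f (act g x) \<otimes>\<^bsub>H\<^esub> f' (act (inv\<^bsub>G\<^esub> g) (act g x)) else \<one>\<^bsub>H\<^esub>) = \<one>\<^bsub>H\<^esub>"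
        using fg nB unfolding supported_def by fast
      then show False
        using x xP fc nB A.act_inv(1)[OF gc(1) xP] A.act_closed[OF gc(1) xP] by simp
    qed
    \<comment> \<open>Consequently a nontrivial translated value on the finite side sits at the
      image of a point of \<open>B\<close> and comes from a nontrivial value of
      \<open>f'\<close>.\<close>
    have hit: "\<exists>x\<in>B. f' x \<noteq> \<one>\<^bsub>H\<^esub> \<and> act g x \<in> B \<and> y = i (act g x)" if y: "y \<in> P'" "push_forward H B i f' (act' (inv\<^bsub>G'\<^esub> (\<psi> g)) y) \<noteq> \<one>\<^bsub>H\<^esub>"
    proof -
      have "act' (inv\<^bsub>G'\<^esub> (\<psi> g)) y \<in> i ` B"
        using y(2) push_forward_outside by metis
      then obtain x where x: "x \<in> B" "act' (inv\<^bsub>G'\<^esub> (\<psi> g)) y = i x" by blast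
      then have "f' x \<noteq> \<one>\<^bsub>H\<^esub>" using y(2) app[OF x(1), of H f'] by simp
      moreover from stay[OF x(1) this] have "act g x \<in> B" .
      moreover have "y = i (act g x)"
        using equiv[OF g x(1) \<open>act g x \<in> B\<close>] A'.act_inv(2)[OF gc(2) y(1)] x(2) by simp
      ultimately show ?thesis using x(1) by blast
    qed
    show ?thesis
    proof (cases "y \<in> i ` B")
      case False
      then have "push_forward H B i f' (act' (inv\<^bsub>G'\<^esub> (\<psi> g)) y) = \<one>\<^bsub>H\<^esub>" if "y \<in> P'"
        using hit that by blast
      with False show ?thesis by (simp add: push_forward_outside)
    next
      case True
      then obtain z where z: "z \<in> B" "y = i z" by blast
      have zP: "z \<in> P" "y \<in> P'" using z B by auto
      have "push_forward H B i f' (act' (inv\<^bsub>G'\<^esub> (\<psi> g)) y) = f' (act (inv\<^bsub>G\<^esub> g) z)"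
      proof (cases "act (inv\<^bsub>G\<^esub> g) z \<in> B")
        case True
        have "y = act' (\<psi> g) (i (act (inv\<^bsub>G\<^esub> g) z))"
          using equiv[OF g True] A.act_inv(2)[OF gc(1) zP(1)] z by simp
        then have "act' (inv\<^bsub>G'\<^esub> (\<psi> g)) y = i (act (inv\<^bsub>G\<^esub> g) z)"
          using A'.act_inv(1)[OF gc(2)] True B(2) by auto
        then show ?thesis using app[OF True] by simp
      next
        case False
        \<comment> \<open>By \<open>hit\<close> and injectivity of \<open>i\<close>, a nontrivial
          value would put the translate of \<open>z\<close> by the inverse of \<open>g\<close> into
          \<open>B\<close>.\<close>
        have "push_forward H B i f' (act' (inv\<^bsub>G'\<^esub> (\<psi> g)) y) = \<one>\<^bsub>H\<^esub>"
        proof (rule ccontr)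
          assume "\<not> ?thesis"
          from hit[OF zP(2) this] obtain x where x: "x \<in> B" "act g x \<in> B" "y = i (act g x)"
            by blast
          have "z = act g x" using inj_onD[OF B(3) x(3)[unfolded z(2)] z(1) x(2)] .
          moreover have "act (inv\<^bsub>G\<^esub> g) (act g x) = x"
            using A.act_inv(1)[OF gc(1)] x(1) B(1) by blast
          ultimately show False using False x(1) by simp
        qed
        with fc(4)[OF False] show ?thesis by simp
      qed
      then show ?thesis using z zP by (simp add: app)
    qed
  qed
  show ?thesis
    unfolding local_embedding_def
  proof (intro conjI inj)
    show "supported H B \<times> F \<subseteq> carrier (wreath H G P act)"
      using B(1) F by (auto simp: A.carrier_W supported_def)
    show "(\<lambda>(f, g). (push_forward H B i f, \<psi> g)) ` (supported H B \<times> F) \<subseteq> carrier (wreath H G' P' act')"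
      using B(2)[unfolded image_subset_iff] \<psi>F by (auto simp: A'.carrier_W supported_def push_forward_def)
    show "\<forall>a\<in>supported H B \<times> F. \<forall>b\<in>supported H B \<times> F. a \<otimes>\<^bsub>wreath H G P act\<^esub> b \<in> supported H B \<times> F \<longrightarrow>
        (\<lambda>(f, g). (push_forward H B i f, \<psi> g)) (a \<otimes>\<^bsub>wreath H G P act\<^esub> b) =
        (\<lambda>(f, g). (push_forward H B i f, \<psi> g)) a \<otimes>\<^bsub>wreath H G' P' act'\<^esub>
        (\<lambda>(f, g). (push_forward H B i f, \<psi> g)) b"
    proof (intro ballI impI)
      fix a b assume ab: "a \<in> supported H B \<times> F" "b \<in> supported H B \<times> F"
        "a \<otimes>\<^bsub>wreath H G P act\<^esub> b \<in> supported H B \<times> F"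
      obtain f g f' g' where eq: "a = (f, g)" "b = (f', g')" by (cases a; cases b)
      have *: "f \<in> supported H B" "g \<in> F" "f' \<in> supported H B" "g' \<in> F"
        using ab by (auto simp: eq)
      have supp: "(\<lambda>x. if x \<in> P then f x \<otimes>\<^bsub>H\<^esub> f' (act (inv\<^bsub>G\<^esub> g) x) else \<one>\<^bsub>H\<^esub>) \<in> supported H B"
        and "g \<otimes>\<^bsub>G\<^esub> g' \<in> F"
        using ab(3) by (simp_all add: eq A.mult_W)
      then have "\<psi> (g \<otimes>\<^bsub>G\<^esub> g') = \<psi> g \<otimes>\<^bsub>G'\<^esub> \<psi> g'"
        using \<psi> * by (auto simp: local_embedding_def)
      then show "(\<lambda>(f, g). (push_forward H B i f, \<psi> g)) (a \<otimes>\<^bsub>wreath H G P act\<^esub> b) =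
          (\<lambda>(f, g). (push_forward H B i f, \<psi> g)) a \<otimes>\<^bsub>wreath H G' P' act'\<^esub>
          (\<lambda>(f, g). (push_forward H B i f, \<psi> g)) b"
        by (simp add: eq A.mult_W A'.mult_W ext[OF hom[OF *(1,3,2) supp]])
    qed
  qed
qed

section \<open>Cardinality of base groups\<close>

lemma bij_betw_supported:
  assumes "\<one>\<^bsub>H\<^esub> \<in> carrier H"
  shows "bij_betw (\<lambda>f. restrict f P) (supported H P) (P \<rightarrow>\<^sub>E carrier H)"
proof (rule bij_betw_byWitness[where f' = "\<lambda>f x. if x \<in> P then f x else \<one>\<^bsub>H\<^esub>"])
  show "(\<lambda>f x. if x \<in> P then f x else \<one>\<^bsub>H\<^esub>) ` (P \<rightarrow>\<^sub>E carrier H) \<subseteq> supported H P"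
    using assms by (auto simp: supported_def)
qed (auto simp: supported_def fun_eq_iff extensional_def PiE_def)

lemma card_supported:
  assumes "\<one>\<^bsub>H\<^esub> \<in> carrier H" "finite P"
  shows "card (supported H P) = card (carrier H) ^ card P"
  using bij_betw_same_card[OF bij_betw_supported[OF assms(1), of P]] assms(2)
  by (simp add: card_PiE)

lemma finite_supported:
  assumes "\<one>\<^bsub>H\<^esub> \<in> carrier H" "finite P" "finite (carrier H)"
  shows "finite (supported H P)"
  using bij_betw_finite[OF bij_betw_supported[OF assms(1), of P]] assms(2,3)
  by (simp add: finite_PiE)

section \<open>Iterated wreath products\<close>

abbreviation cyc :: "nat \<Rightarrow> int monoid" where
  "cyc \<equiv> integer_mod_group"

definition lamplighter :: "('h, 'm) monoid_scheme \<Rightarrow> nat \<Rightarrow> ((int \<Rightarrow> 'h) \<times> int) monoid" where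
  "lamplighter H m = wreath H (cyc m) (carrier (cyc m)) (monoid.mult (cyc m))"

text \<open>The points are the cosets of the subgroup of lamp configurations supported off \<open>D\<close>: such a
  coset has a unique representative \<open>(A, p)\<close> with \<open>A\<close> supported on \<open>p + D\<close>, and \<open>project\<close>
  computes it. For \<open>m = 0\<close> the group \<open>cyc m\<close> is the group of integers.\<close>

definition project ::
    "('h, 'm) monoid_scheme \<Rightarrow> nat \<Rightarrow> int set \<Rightarrow> (int \<Rightarrow> 'h) \<times> int \<Rightarrow> (int \<Rightarrow> 'h) \<times> int" where
  "project H m D = (\<lambda>(A, p). (\<lambda>i. if (i - p) mod int m \<in> D then A i else \<one>\<^bsub>H\<^esub>, p))"

definition points :: "('h, 'm) monoid_scheme \<Rightarrow> nat \<Rightarrow> int set \<Rightarrow> ((int \<Rightarrow> 'h) \<times> int) set" where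
  "points H m D = {x \<in> carrier (lamplighter H m). project H m D x = x}"

text \<open>The left action on cosets in terms of representatives: translate, then normalise with
  \<open>project\<close>.\<close>

definition double_wreath where
  "double_wreath H m D = wreath H (lamplighter H m) (points H m D)
     (\<lambda>g x. project H m D (g \<otimes>\<^bsub>lamplighter H m\<^esub> x))"

lemma wreath_data_lamplighter:
  assumes "group H"
  shows "wreath_data H (cyc m) (carrier (cyc m)) (monoid.mult (cyc m))"
proof -
  interpret C: group "cyc m" by simp
  show ?thesis
    unfolding wreath_data_def wreath_data_axioms_def
    using assms C.m_assoc by (auto intro: C.m_closed simp del: mult_integer_mod_group one_integer_mod_group)
qed

locale lamps =
  fixes H :: "('h, 'm) monoid_scheme" and m :: nat and D :: "int set"
  assumes group_H: "group H"
begin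

sublocale H: group H by (rule group_H)

sublocale C: group "cyc m" by simp

sublocale L: wreath_data H "cyc m" "carrier (cyc m)" "monoid.mult (cyc m)"
  rewrites "wreath H (cyc m) (carrier (cyc m)) (monoid.mult (cyc m)) = lamplighter H m"
  by (rule wreath_data_lamplighter[OF group_H]) (simp add: lamplighter_def)

lemma project_closed:
  "x \<in> carrier (lamplighter H m) \<Longrightarrow> project H m D x \<in> carrier (lamplighter H m)"
  by (cases x) (auto simp: project_def L.carrier_W supported_def)

lemma project_idem [simp]: "project H m D (project H m D x) = project H m D x"
  by (cases x) (auto simp: project_def)

text \<open>Makes left translation well defined on cosets. Membership in \<open>D\<close> is tested
  at the position relative to the second component, and translation by \<open>g\<close> leaves this
  relative position unchanged.\<close>

lemma project_mult:
  assumes "g \<in> carrier (lamplighter H m)" "x \<in> carrier (lamplighter H m)"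
  shows "project H m D (g \<otimes>\<^bsub>lamplighter H m\<^esub> project H m D x) =
    project H m D (g \<otimes>\<^bsub>lamplighter H m\<^esub> x)"
proof (cases g; cases x)
  fix c k A p assume eq: "g = (c, k)" "x = (A, p)"
  then have k: "k \<in> carrier (cyc m)" using assms by (auto simp: L.carrier_W)
  have "(((- k) mod int m + i) mod int m - p) mod int m = (i - (k + p) mod int m) mod int m" for i
    by (simp add: mod_simps algebra_simps)
  then show ?thesis
    using k by (auto simp: eq project_def L.mult_W fun_eq_iff)
qed

sublocale W: wreath_data H "lamplighter H m" "points H m D"
    "\<lambda>g x. project H m D (g \<otimes>\<^bsub>lamplighter H m\<^esub> x)"
  rewrites "wreath H (lamplighter H m) (points H m D)
    (\<lambda>g x. project H m D (g \<otimes>\<^bsub>lamplighter H m\<^esub> x)) = double_wreath H m D"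
proof -
  show "wreath_data H (lamplighter H m) (points H m D)
    (\<lambda>g x. project H m D (g \<otimes>\<^bsub>lamplighter H m\<^esub> x))"
    unfolding wreath_data_def wreath_data_axioms_def
    using group_H L.W.group_axioms
    by (auto simp: points_def project_closed project_mult L.W.m_assoc)
qed (simp add: double_wreath_def)

end

section \<open>Reduction modulo m on bounded windows\<close>

lemma local_embedding_cyc:
  assumes "4 * n < m"
  shows "local_embedding (cyc 0) (cyc m) {-2 * int n..2 * int n} (\<lambda>k. k mod int m)"
proof -
  have "k = l" if "k \<in> {-2 * int n..2 * int n}" "l \<in> {-2 * int n..2 * int n}"
    "k mod int m = l mod int m" for k l
  proof -
    have "int m dvd k - l" using that(3) by (simp add: mod_eq_dvd_iff)
    \<comment> \<open>Two elements of the window differ by at most \<open>4 * n\<close>, less than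
      \<open>m\<close>.\<close>
    moreover have "\<bar>k - l\<bar> < int m" using that(1,2) assms by auto
    ultimately show ?thesis using dvd_imp_le_int[of "k - l" "int m"] by (cases "k = l") auto
  qed
  then have "inj_on (\<lambda>k. k mod int m) {-2 * int n..2 * int n}"
    by (rule inj_onI)
  then show ?thesis
    using assms by (auto simp: local_embedding_def carrier_integer_mod_group mod_simps)
qed

text \<open>Explicit boxes stand in for word balls; radii add under multiplication
  (\<open>lamp_ball_mult\<close>). \<open>dw_ball\<close> does the same one level up.\<close>

definition lamp_ball :: "('h, 'm) monoid_scheme \<Rightarrow> nat \<Rightarrow> ((int \<Rightarrow> 'h) \<times> int) set" where
  "lamp_ball H n = supported H {-int n..int n} \<times> {-int n..int n}"

definition dw_ball where
  "dw_ball H D n = supported H (points H 0 D \<inter> lamp_ball H n) \<times> lamp_ball H n"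

text \<open>The window has radius \<open>2 * n\<close> because the action involves products of two
  elements of radius \<open>n\<close>.\<close>

definition reduce :: "('h, 'm) monoid_scheme \<Rightarrow> nat \<Rightarrow> nat \<Rightarrow> (int \<Rightarrow> 'h) \<times> int \<Rightarrow> (int \<Rightarrow> 'h) \<times> int" where
  "reduce H n m =
     (\<lambda>(f, k). (push_forward H {-2 * int n..2 * int n} (\<lambda>k. k mod int m) f, k mod int m))"

lemma local_embedding_lamplighter:
  assumes "group H" "4 * n < m"
  shows "local_embedding (lamplighter H 0) (lamplighter H m) (lamp_ball H (2 * n)) (reduce H n m)"
proof -
  note C = local_embedding_cyc[OF assms(2)]
  have "local_embedding (lamplighter H 0) (lamplighter H m)
    (supported H {-2 * int n..2 * int n} \<times> {-2 * int n..2 * int n}) (reduce H n m)"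
    unfolding lamplighter_def reduce_def
  proof (rule local_embedding_wreath[OF wreath_data_lamplighter wreath_data_lamplighter C])
    show "inj_on (\<lambda>k. k mod int m) {-2 * int n..2 * int n}"
      using C by (simp add: local_embedding_def)
  qed (use assms in \<open>auto simp: carrier_integer_mod_group mod_simps\<close>)
  then show ?thesis by (simp add: lamp_ball_def)
qed

lemma lamp_ball_mult:
  assumes H: "group H" and "g \<in> lamp_ball H a" "h \<in> lamp_ball H b"
  shows "g \<otimes>\<^bsub>lamplighter H 0\<^esub> h \<in> lamp_ball H (a + b)"
proof (cases g; cases h)
  fix c k d l assume eq: "g = (c, k)" "h = (d, l)"
  interpret lamps H 0 "{}" by (rule lamps.intro[OF H])
  have *: "c i \<in> carrier H" "d i \<in> carrier H" "i \<notin> {-int a..int a} \<Longrightarrow> c i = \<one>\<^bsub>H\<^esub>"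
    "i \<notin> {-int b..int b} \<Longrightarrow> d i = \<one>\<^bsub>H\<^esub>" "k \<in> {-int a..int a}" "l \<in> {-int b..int b}" for i
    using assms by (auto simp: eq lamp_ball_def supported_def)
  have "(\<lambda>i. c i \<otimes>\<^bsub>H\<^esub> d (i - k)) \<in> supported H {-int (a + b)..int (a + b)}"
  proof -
    have "c i \<otimes>\<^bsub>H\<^esub> d (i - k) = \<one>\<^bsub>H\<^esub>" if "i \<notin> {-int (a + b)..int (a + b)}" for i
    proof -
      have "i \<notin> {-int a..int a}" "i - k \<notin> {-int b..int b}" using that *(5) by auto
      then show ?thesis using * by simp
    qed
    then show ?thesis using * by (simp add: supported_def)
  qed
  moreover have "g \<otimes>\<^bsub>lamplighter H 0\<^esub> h = (\<lambda>i. c i \<otimes>\<^bsub>H\<^esub> d (i - k), k + l)"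
    by (simp add: eq L.mult_W carrier_integer_mod_group)
  ultimately show ?thesis
    using *(5,6) by (auto simp: lamp_ball_def)
qed

lemma project_lamp_ball:
  "\<one>\<^bsub>H\<^esub> \<in> carrier H \<Longrightarrow> x \<in> lamp_ball H n \<Longrightarrow> project H m D x \<in> lamp_ball H n"
  by (cases x) (auto simp: lamp_ball_def project_def supported_def)

text \<open>For positions in the window, \<open>i - p\<close> lies between \<open>-4 * n\<close> and
  \<open>4 * n\<close>. A nonnegative difference survives reduction. A negative one becomes
  \<open>i - p + m\<close>, which exceeds \<open>4 * n\<close> as \<open>m > 8 * n\<close> and so
  misses the truncated set, while \<open>D\<close> itself has no negative element.\<close>

lemma project_reduce:
  assumes m: "8 * n < m" and D: "D \<subseteq> {0..}" and x: "x \<in> lamp_ball H (2 * n)"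
  shows "project H m (D \<inter> {0..4 * int n}) (reduce H n m x) = reduce H n m (project H 0 D x)"
proof (cases x)
  case (Pair A p)
  define I where "I = {-2 * int n..2 * int n}"
  let ?\<rho> = "\<lambda>k. k mod int m"
  have inj: "inj_on ?\<rho> I"
    using local_embedding_cyc[of n m] m by (simp add: local_embedding_def I_def)
  have p: "p \<in> I" using x by (auto simp: Pair lamp_ball_def I_def)
  have "(if (y - p mod int m) mod int m \<in> D \<inter> {0..4 * int n} then push_forward H I ?\<rho> A y
      else \<one>\<^bsub>H\<^esub>) = push_forward H I ?\<rho> (\<lambda>i. if (i - p) mod int 0 \<in> D then A i else \<one>\<^bsub>H\<^esub>) y" for y
  proof (cases "y \<in> ?\<rho> ` I")
    case True
    then obtain i where i: "i \<in> I" "y = i mod int m" by blast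
    have "(i - p) mod int m \<in> D \<inter> {0..4 * int n} \<longleftrightarrow> i - p \<in> D"
    proof (cases "i - p \<ge> 0")
      case True
      then have "(i - p) mod int m = i - p" using i p m by (simp add: I_def)
      then show ?thesis using i p D by (auto simp: I_def)
    next
      case False
      have "(i - p) mod int m = (i - p + int m) mod int m" by simp
      also have "\<dots> = i - p + int m" using False i p m by (intro mod_pos_pos_trivial) (auto simp: I_def)
      finally have "(i - p) mod int m > 4 * int n" using i p m by (auto simp: I_def)
      then show ?thesis using False D by auto
    qed
    then show ?thesis
      using push_forward_apply[OF inj i(1), of H] by (simp add: i(2) mod_simps)
  qed (simp add: push_forward_outside)
  from this show ?thesis
    unfolding Pair project_def reduce_def prod.case I_def[symmetric]
    by (intro arg_cong2[where f = Pair] ext refl)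
qed

text \<open>\<open>local_embedding_wreath\<close> is used a second time, now with the lamplighter
  groups on top. Equivariance follows from \<open>project_reduce\<close> at the product of
  \<open>g\<close> and \<open>x\<close>.\<close>

lemma local_embedding_double_wreath:
  assumes H: "group H" and m: "8 * n < m" and D: "D \<subseteq> {0..}"
  obtains \<phi> where
    "local_embedding (double_wreath H 0 D) (double_wreath H m (D \<inter> {0..4 * int n})) (dw_ball H D n) \<phi>"
proof -
  define D' where "D' = D \<inter> {0..4 * int n}"
  interpret A: lamps H 0 D by (rule lamps.intro[OF H])
  interpret B: lamps H m D' by (rule lamps.intro[OF H])
  have emb: "local_embedding (lamplighter H 0) (lamplighter H m) (lamp_ball H (2 * n)) (reduce H n m)"
    using local_embedding_lamplighter[OF H, of n m] m by simp
  have sub: "lamp_ball H n \<subseteq> lamp_ball H (2 * n)"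
    by (auto simp: lamp_ball_def supported_def)
  have "local_embedding (double_wreath H 0 D) (double_wreath H m D')
      (supported H (points H 0 D \<inter> lamp_ball H n) \<times> lamp_ball H n)
      (\<lambda>(f, g). (push_forward H (points H 0 D \<inter> lamp_ball H n) (reduce H n m) f, reduce H n m g))"
    unfolding double_wreath_def
  proof (rule local_embedding_wreath[OF A.W.wreath_data_axioms B.W.wreath_data_axioms
        local_embedding_subset[OF emb sub]])
    show "inj_on (reduce H n m) (points H 0 D \<inter> lamp_ball H n)"
      using emb sub by (auto simp: local_embedding_def intro: inj_on_subset)
    show "reduce H n m ` (points H 0 D \<inter> lamp_ball H n) \<subseteq> points H m D'"
    proof (rule image_subsetI)
      fix x assume x: "x \<in> points H 0 D \<inter> lamp_ball H n"
      then have x2: "x \<in> lamp_ball H (2 * n)" using sub by blast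
      have "reduce H n m x \<in> carrier (lamplighter H m)"
        using emb x2 by (auto simp: local_embedding_def)
      moreover have "project H m D' (reduce H n m x) = reduce H n m x"
        using project_reduce[OF m D x2] x by (simp add: D'_def points_def)
      ultimately show "reduce H n m x \<in> points H m D'" by (simp add: points_def)
    qed
    fix g x assume *: "g \<in> lamp_ball H n" "x \<in> points H 0 D \<inter> lamp_ball H n"
    \<comment> \<open>The product may leave the box of radius \<open>n\<close> but stays in the
      larger box, on which \<open>reduce\<close> is a local embedding.\<close>
    have gx: "g \<otimes>\<^bsub>lamplighter H 0\<^esub> x \<in> lamp_ball H (2 * n)"
      using lamp_ball_mult[OF H *(1), of x n] *(2) by (simp add: mult_2)
    then have "reduce H n m (g \<otimes>\<^bsub>lamplighter H 0\<^esub> x) = reduce H n m g \<otimes>\<^bsub>lamplighter H m\<^esub> reduce H n m x"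
      using * sub by (intro local_embedding_mult[OF emb]) auto
    then show "reduce H n m (project H 0 D (g \<otimes>\<^bsub>lamplighter H 0\<^esub> x)) =
        project H m D' (reduce H n m g \<otimes>\<^bsub>lamplighter H m\<^esub> reduce H n m x)"
      using project_reduce[OF m D gx] by (simp add: D'_def)
  qed auto
  then show thesis using that by (simp add: dw_ball_def D'_def)
qed

section \<open>Word balls of the double wreath product over the integers\<close>

lemma lamp_ball_mono: "a \<le> b \<Longrightarrow> lamp_ball H a \<subseteq> lamp_ball H b"
  by (auto simp: lamp_ball_def supported_def)

lemma lamp_ball_carrier: "lamp_ball H n \<subseteq> carrier (lamplighter H 0)"
  by (auto simp: lamp_ball_def lamplighter_def wreath_def supported_def carrier_integer_mod_group)

text \<open>The shift of the lamplighter, its switch at the origin, and two elements of the copy of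
  \<open>H\<close> over the trivial coset. The single switch value \<open>a\<close> is enough to
  record subsets; \<open>a\<close> and \<open>b\<close> are later chosen not to commute.\<close>

definition double_gens where
  "double_gens H a b =
     {top_elt H (top_elt H 1), top_elt H (base_elt H (cyc 0) 0 a),
      base_elt H (lamplighter H 0) \<one>\<^bsub>lamplighter H 0\<^esub> a,
      base_elt H (lamplighter H 0) \<one>\<^bsub>lamplighter H 0\<^esub> b}"

locale double_wreath_0 =
  fixes H :: "('h, 'm) monoid_scheme" and D :: "int set" and a b :: 'h
  assumes group_H: "group H"
    and ab: "a \<in> carrier H" "b \<in> carrier H"
begin

sublocale lamps H 0 D by (rule lamps.intro[OF group_H])

abbreviation L where "L \<equiv> lamplighter H 0"
abbreviation DW where "DW \<equiv> double_wreath H 0 D"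
abbreviation gens where "gens \<equiv> double_gens H a b"

lemma cyc0: "carrier (cyc 0) = UNIV" "inv\<^bsub>cyc 0\<^esub> k = - k"
  by (simp_all add: carrier_integer_mod_group)

lemma mult_L: "(c, k) \<otimes>\<^bsub>L\<^esub> (d, l) = (\<lambda>i. c i \<otimes>\<^bsub>H\<^esub> d (i - k), k + l)"
  by (simp add: L.mult_W cyc0)

lemma one_L: "\<one>\<^bsub>L\<^esub> = (\<lambda>_. \<one>\<^bsub>H\<^esub>, 0)"
  by (simp add: L.one_W)

lemma one_points: "\<one>\<^bsub>L\<^esub> \<in> points H 0 D"
  by (simp add: points_def) (simp add: one_L project_def)

lemma dw_ball_carrier: "dw_ball H D n \<subseteq> carrier DW"
  using lamp_ball_carrier by (auto simp: dw_ball_def W.carrier_W supported_def)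

lemma dw_ball_mult:
  assumes "g \<in> dw_ball H D m" "h \<in> dw_ball H D n"
  shows "g \<otimes>\<^bsub>DW\<^esub> h \<in> dw_ball H D (m + n)"
proof (cases g; cases h)
  fix f k f' l assume eq: "g = (f, k)" "h = (f', l)"
  have *: "f \<in> supported H (points H 0 D \<inter> lamp_ball H m)" "k \<in> lamp_ball H m"
    "f' \<in> supported H (points H 0 D \<inter> lamp_ball H n)" "l \<in> lamp_ball H n"
    using assms by (auto simp: eq dw_ball_def)
  have k: "k \<in> carrier L" using * lamp_ball_carrier by blast
  let ?z = "\<lambda>x. project H 0 D (inv\<^bsub>L\<^esub> k \<otimes>\<^bsub>L\<^esub> x)"
  have "f x \<otimes>\<^bsub>H\<^esub> f' (?z x) = \<one>\<^bsub>H\<^esub>" if "x \<in> points H 0 D" "x \<notin> lamp_ball H (m + n)" for x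
  proof -
    have "x \<notin> lamp_ball H m" using that(2) lamp_ball_mono[of m "m + n" H] by auto
    moreover have "?z x \<notin> lamp_ball H n"
    proof
      assume z: "?z x \<in> lamp_ball H n"
      \<comment> \<open>\<open>x\<close> is recovered by acting with \<open>k\<close> on its
        translate, and acting adds at most \<open>m\<close> to the radius.\<close>
      have "x = project H 0 D (k \<otimes>\<^bsub>L\<^esub> ?z x)" using W.act_inv(2)[OF k that(1)] by simp
      also have "\<dots> \<in> lamp_ball H (m + n)"
        using lamp_ball_mult[OF group_H *(2) z] by (intro project_lamp_ball) auto
      finally show False using that by blast
    qed
    ultimately show ?thesis
      using supported_outside[OF *(1)] supported_outside[OF *(3)] by simp
  qed
  then have "(\<lambda>x. if x \<in> points H 0 D then f x \<otimes>\<^bsub>H\<^esub> f' (?z x) else \<one>\<^bsub>H\<^esub>)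
      \<in> supported H (points H 0 D \<inter> lamp_ball H (m + n))"
    unfolding supported_def using supported_closed[OF *(1)] supported_closed[OF *(3)] by auto
  then show ?thesis
    using lamp_ball_mult[OF group_H *(2,4)] by (simp add: eq W.mult_W dw_ball_def)
qed

lemma top_elt_dw_ball: "g \<in> lamp_ball H n \<Longrightarrow> top_elt H g \<in> dw_ball H D n"
  by (simp add: top_elt_def dw_ball_def supported_def)

lemma one_lamp_ball: "\<one>\<^bsub>L\<^esub> \<in> lamp_ball H n"
  by (simp add: one_L lamp_ball_def supported_def)

lemma base_elt_dw_ball: "h \<in> carrier H \<Longrightarrow> base_elt H L \<one>\<^bsub>L\<^esub> h \<in> dw_ball H D n"
  using one_lamp_ball[of n] one_points by (auto simp: base_elt_def dw_ball_def supported_def)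

lemma gens_closed: "gens \<subseteq> carrier DW"
  using ab one_points
  by (auto simp: double_gens_def L.top_elt_closed L.base_elt_closed W.top_elt_closed W.base_elt_closed cyc0)

lemma word_ball_subset_dw_ball: "word_ball DW gens n \<subseteq> dw_ball H D n"
proof (rule W.W.word_ball_minimal[OF gens_closed])
  show "\<one>\<^bsub>DW\<^esub> \<in> dw_ball H D n" for n
    using one_lamp_ball[of n] by (auto simp: W.one_W dw_ball_def supported_def)
  have shift: "top_elt H k \<in> lamp_ball H 1" if "k \<in> {-1..1}" for k
    using that by (simp add: top_elt_def lamp_ball_def supported_def)
  have switch: "base_elt H (cyc 0) 0 h \<in> lamp_ball H 1" if "h \<in> carrier H" for h
    using that by (simp add: base_elt_def lamp_ball_def supported_def)
  fix s assume s: "s \<in> gens"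
  then show "s \<in> dw_ball H D 1"
    using ab shift[of 1] switch by (auto simp: double_gens_def intro: top_elt_dw_ball base_elt_dw_ball)
  have "inv\<^bsub>DW\<^esub> (top_elt H (top_elt H 1)) = top_elt H (top_elt H (- 1))"
    by (subst W.top_elt_inv) (simp_all add: L.top_elt_closed L.top_elt_inv cyc0)
  moreover have "inv\<^bsub>DW\<^esub> (top_elt H (base_elt H (cyc 0) 0 a)) = top_elt H (base_elt H (cyc 0) 0 (inv\<^bsub>H\<^esub> a))"
    using ab by (subst W.top_elt_inv) (simp_all add: L.base_elt_closed L.base_elt_inv cyc0)
  ultimately show "inv\<^bsub>DW\<^esub> s \<in> dw_ball H D 1"
    using s ab shift[of "-1"] switch[of "inv\<^bsub>H\<^esub> a"] one_points
      base_elt_dw_ball[OF H.inv_closed[OF ab(1)], of 1] base_elt_dw_ball[OF H.inv_closed[OF ab(2)], of 1]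
    by (auto simp: double_gens_def W.base_elt_inv intro: top_elt_dw_ball)
qed (use dw_ball_carrier dw_ball_mult in auto)

section \<open>Marked subsets and the lower bound on the order\<close>

definition marker :: "int set \<Rightarrow> (int \<Rightarrow> 'h) \<times> int" where
  "marker A = (\<lambda>i. if i \<in> A then a else \<one>\<^bsub>H\<^esub>, 0)"

lemma marker_closed: "marker A \<in> carrier L"
  using ab by (simp add: marker_def L.carrier_W cyc0 supported_def)

text \<open>With second component 0 and all switched lamps in \<open>D\<close>, nothing is erased by
  \<open>project\<close>: the element \<open>marker A\<close> is also the representative of its own
  coset. So subsets of \<open>D\<close> label points.\<close>

lemma marker_points: "A \<subseteq> D \<Longrightarrow> marker A \<in> points H 0 D"
  unfolding points_def using marker_closed by (auto simp: marker_def project_def fun_eq_iff)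

lemma marker_inj: "a \<noteq> \<one>\<^bsub>H\<^esub> \<Longrightarrow> marker A = marker B \<Longrightarrow> A = B"
  by (auto simp: marker_def fun_eq_iff split: if_splits)

text \<open>The lamplighter walks to \<open>n\<close>, switching the lamps of \<open>A\<close> on
  the way at no more than two letters per position, and returns with \<open>n\<close> further
  letters.\<close>

lemma marker_word_ball:
  assumes "A \<subseteq> {0..<int n}"
  shows "top_elt H (marker A) \<in> word_ball DW gens (3 * n)"
proof -
  \<comment> \<open>State after \<open>j\<close> positions: the lamps of \<open>A\<close> below
    \<open>j\<close> are switched and the lamplighter stands at \<open>j\<close>, whose lamp is
    still untouched.\<close>
  let ?walk = "\<lambda>j. (\<lambda>i. if i \<in> A \<inter> {0..<int j} then a else \<one>\<^bsub>H\<^esub>, int j)"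
  have walk_closed: "?walk j \<in> carrier L" for j
    using ab by (simp add: L.carrier_W cyc0 supported_def)
  have shift: "top_elt H 1 \<in> carrier L" by (simp add: L.top_elt_closed cyc0)
  have switch: "base_elt H (cyc 0) 0 a \<in> carrier L" using ab by (simp add: L.base_elt_closed cyc0)
  have walk: "top_elt H (?walk j) \<in> word_ball DW gens (2 * j)" for j
  proof (induction j)
    case 0
    then show ?case using W.W.one_word_ball[OF gens_closed, of 0] by (simp add: W.one_W top_elt_def one_L)
  next
    case (Suc j)
    have step1: "top_elt H (top_elt H 1) \<in> word_ball DW gens 1"
      by (rule W.W.gen_word_ball[OF gens_closed]) (simp add: double_gens_def)
    have gen2: "top_elt H (base_elt H (cyc 0) 0 a) \<in> word_ball DW gens 1"
      by (rule W.W.gen_word_ball[OF gens_closed]) (simp add: double_gens_def)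
    \<comment> \<open>A position outside \<open>A\<close> uses the identity in place of the switch,
      so both cases fit into radius 1.\<close>
    obtain s where s: "s \<in> carrier L" "top_elt H s \<in> word_ball DW gens 1"
      "s = (\<lambda>i. if i = 0 \<and> int j \<in> A then a else \<one>\<^bsub>H\<^esub>, 0)"
    proof (cases "int j \<in> A")
      case True
      then show ?thesis using that[OF switch gen2] by (simp add: base_elt_def)
    next
      case False
      have "\<one>\<^bsub>DW\<^esub> = top_elt H \<one>\<^bsub>L\<^esub>" by (simp add: W.one_W top_elt_def)
      then show ?thesis using False that[of "\<one>\<^bsub>L\<^esub>"] W.W.one_word_ball[OF gens_closed, of 1]
        by (simp add: one_L L.carrier_W supported_def)
    qed
    have "?walk j \<otimes>\<^bsub>L\<^esub> s \<otimes>\<^bsub>L\<^esub> top_elt H 1 = ?walk (Suc j)"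
    proof -
      have "(if i \<in> A \<inter> {0..<int j} then a else \<one>\<^bsub>H\<^esub>) \<otimes>\<^bsub>H\<^esub>
          (if i - int j = 0 \<and> int j \<in> A then a else \<one>\<^bsub>H\<^esub>) \<otimes>\<^bsub>H\<^esub> \<one>\<^bsub>H\<^esub> =
          (if i \<in> A \<inter> {0..<int (Suc j)} then a else \<one>\<^bsub>H\<^esub>)" for i
        using ab by (cases "i = int j") auto
      from ext[OF this] show ?thesis
        unfolding s(3) mult_L top_elt_def prod.inject by simp
    qed
    then have "top_elt H (?walk (Suc j)) =
        top_elt H (?walk j) \<otimes>\<^bsub>DW\<^esub> top_elt H s \<otimes>\<^bsub>DW\<^esub> top_elt H (top_elt H 1)"
      using walk_closed[of j] s(1) by (simp add: W.top_elt_mult)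
    then show ?case
      using W.W.word_ball_mult[OF gens_closed W.W.word_ball_mult[OF gens_closed Suc s(2)] step1]
      by simp
  qed
  have return: "top_elt H (top_elt H (- int j)) \<in> word_ball DW gens j" for j
  proof (induction j)
    case 0
    then show ?case using W.W.one_word_ball[OF gens_closed, of 0] by (simp add: W.one_W top_elt_def one_L)
  next
    case (Suc j)
    have "top_elt H (top_elt H (- 1)) = inv\<^bsub>DW\<^esub> (top_elt H (top_elt H 1))"
      using shift by (simp add: W.top_elt_inv L.top_elt_inv cyc0)
    also have "\<dots> \<in> word_ball DW gens 1"
      by (rule W.W.inv_gen_word_ball[OF gens_closed]) (simp add: double_gens_def)
    finally have "top_elt H (top_elt H (- int j)) \<otimes>\<^bsub>DW\<^esub> top_elt H (top_elt H (- 1)) \<in> word_ball DW gens (j + 1)"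
      using W.W.word_ball_mult[OF gens_closed Suc] by blast
    then show ?case by (simp add: W.top_elt_mult L.top_elt_mult L.top_elt_closed cyc0 algebra_simps)
  qed
  have "marker A = ?walk n \<otimes>\<^bsub>L\<^esub> top_elt H (- int n)"
    using ab assms by (auto simp: marker_def mult_L top_elt_def fun_eq_iff)
  then have "top_elt H (marker A) = top_elt H (?walk n) \<otimes>\<^bsub>DW\<^esub> top_elt H (top_elt H (- int n))"
    using walk_closed[of n] by (simp add: W.top_elt_mult)
  then show ?thesis
    using W.W.word_ball_mult[OF gens_closed walk[of n] return[of n]] by simp
qed

text \<open>Conjugate the generator over the trivial coset by \<open>marker A\<close>, at cost
  \<open>3 * n + 1 + 3 * n\<close>. Acting on the trivial coset gives the point
  \<open>marker A\<close>, since \<open>A\<close> lies in \<open>D\<close>.\<close>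

lemma base_elt_word_ball:
  assumes "A \<subseteq> D \<inter> {0..<int n}" "h \<in> {a, b}"
  shows "base_elt H L (marker A) h \<in> word_ball DW gens (6 * n + 1)"
proof -
  let ?g = "top_elt H (marker A)" and ?s = "base_elt H L \<one>\<^bsub>L\<^esub> h"
  have h: "h \<in> carrier H" using assms(2) ab by auto
  have g: "?g \<in> word_ball DW gens (3 * n)" using assms(1) by (intro marker_word_ball) auto
  have s: "?s \<in> word_ball DW gens 1"
    by (rule W.W.gen_word_ball[OF gens_closed]) (use assms(2) in \<open>auto simp: double_gens_def\<close>)
  have "project H 0 D (marker A \<otimes>\<^bsub>L\<^esub> \<one>\<^bsub>L\<^esub>) = marker A"
    using marker_closed[of A] marker_points[of A] assms(1) by (simp add: points_def)
  then have "base_elt H L (marker A) h = ?g \<otimes>\<^bsub>DW\<^esub> ?s \<otimes>\<^bsub>DW\<^esub> inv\<^bsub>DW\<^esub> ?g"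
    using W.base_elt_conj[OF marker_closed[of A] one_points h] by simp
  also have "\<dots> \<in> word_ball DW gens (3 * n + 1 + 3 * n)"
    using W.W.word_ball_mult[OF gens_closed W.W.word_ball_mult[OF gens_closed g s]
        W.W.word_ball_inv[OF gens_closed g]] .
  finally show ?thesis by (simp add: add.commute flip: mult_2)
qed

text \<open>The radius \<open>12 * n + 2\<close> makes room for products of two elements of radius
  \<open>6 * n + 1\<close>. There \<open>\<phi>\<close> preserves and reflects the commutation
  pattern of the \<open>2 ^ card (D \<inter> {0..<int n})\<close> pairs, which
  \<open>order_ge_of_commuting_pairs\<close> turns into the bound on \<open>order Q\<close>.\<close>

lemma order_lower_bound:
  assumes hom: "group_hom \<Gamma> DW d" and inj: "inj_on d (carrier \<Gamma>)"
    and T: "T \<subseteq> carrier \<Gamma>" "d ` T = gens"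
    and Q: "group Q" "finite (carrier Q)"
      "local_embedding \<Gamma> Q (word_ball \<Gamma> T (12 * n + 2)) \<phi>"
    and nc: "a \<otimes>\<^bsub>H\<^esub> b \<noteq> b \<otimes>\<^bsub>H\<^esub> a"
  shows "2 ^ 2 ^ card (D \<inter> {0..<int n}) \<le> order Q"
proof -
  interpret d: group_hom \<Gamma> DW d by fact
  interpret Q: group Q by fact
  define X where "X = Pow (D \<inter> {0..<int n})"
  have "\<exists>g\<in>word_ball \<Gamma> T (6 * n + 1). d g = base_elt H L (marker A) h" if "A \<in> X" "h \<in> {a, b}" for A h
  proof -
    have "base_elt H L (marker A) h \<in> d ` word_ball \<Gamma> T (6 * n + 1)"
      unfolding d.word_ball_image[OF T(1)] T(2) using that by (intro base_elt_word_ball) (auto simp: X_def)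
    then show ?thesis by (metis imageE)
  qed
  then obtain e where e: "\<And>A h. A \<in> X \<Longrightarrow> h \<in> {a, b} \<Longrightarrow> e A h \<in> word_ball \<Gamma> T (6 * n + 1)"
    "\<And>A h. A \<in> X \<Longrightarrow> h \<in> {a, b} \<Longrightarrow> d (e A h) = base_elt H L (marker A) h"
    by metis
  have ec: "e A h \<in> carrier \<Gamma>" if "A \<in> X" "h \<in> {a, b}" for A h
    using e(1)[OF that] d.G.word_ball_subset_carrier[OF T(1)] by blast
  have prods: "e A h \<otimes>\<^bsub>\<Gamma>\<^esub> e B k \<in> word_ball \<Gamma> T (12 * n + 2)"
    if "A \<in> X" "h \<in> {a, b}" "B \<in> X" "k \<in> {a, b}" for A B h k
  proof -
    have "12 * n + 2 = (6 * n + 1) + (6 * n + 1)" by simp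
    then show ?thesis
      using d.G.word_ball_mult[OF T(1) e(1)[OF that(1,2)] e(1)[OF that(3,4)]] by (simp only:)
  qed
  have big: "e A h \<in> word_ball \<Gamma> T (12 * n + 2)" if "A \<in> X" "h \<in> {a, b}" for A h
    using e(1)[OF that] word_ball_mono[of "6 * n + 1" "12 * n + 2" \<Gamma> T] by auto
  have \<phi>: "\<phi> (e A h \<otimes>\<^bsub>\<Gamma>\<^esub> e B k) = \<phi> (e A h) \<otimes>\<^bsub>Q\<^esub> \<phi> (e B k)"
    if "A \<in> X" "h \<in> {a, b}" "B \<in> X" "k \<in> {a, b}" for A B h k
    using Q(3) prods[OF that] big[OF that(1,2)] big[OF that(3,4)] by (simp add: local_embedding_def)
  have "a \<noteq> \<one>\<^bsub>H\<^esub>" using nc ab by auto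
  \<comment> \<open>As \<open>d\<close> is injective, commutation is decided in the double wreath
    product: over one point by \<open>nc\<close>, over distinct points by disjointness of the
    supports.\<close>
  have comm: "e A a \<otimes>\<^bsub>\<Gamma>\<^esub> e B b = e B b \<otimes>\<^bsub>\<Gamma>\<^esub> e A a \<longleftrightarrow> A \<noteq> B" if "A \<in> X" "B \<in> X" for A B
  proof -
    have mp: "marker A \<in> points H 0 D" "marker B \<in> points H 0 D"
      using that by (auto simp: X_def intro!: marker_points)
    have "e A a \<otimes>\<^bsub>\<Gamma>\<^esub> e B b = e B b \<otimes>\<^bsub>\<Gamma>\<^esub> e A a \<longleftrightarrow>
        d (e A a \<otimes>\<^bsub>\<Gamma>\<^esub> e B b) = d (e B b \<otimes>\<^bsub>\<Gamma>\<^esub> e A a)"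
      using inj ec that by (intro inj_on_eq_iff[symmetric]) auto
    also have "\<dots> \<longleftrightarrow> base_elt H L (marker A) a \<otimes>\<^bsub>DW\<^esub> base_elt H L (marker B) b =
        base_elt H L (marker B) b \<otimes>\<^bsub>DW\<^esub> base_elt H L (marker A) a"
      using ec that e(2) by simp
    also have "\<dots> \<longleftrightarrow> A \<noteq> B"
    proof (cases "A = B")
      case True
      have "base_elt H L (marker B) (a \<otimes>\<^bsub>H\<^esub> b) \<noteq> base_elt H L (marker B) (b \<otimes>\<^bsub>H\<^esub> a)"
        using nc by (auto simp: base_elt_def dest!: fun_cong[where x = "marker B"])
      then show ?thesis using True mp ab by (simp add: W.base_elt_mult)
    next
      case False
      then have "marker A \<noteq> marker B" using marker_inj[OF \<open>a \<noteq> \<one>\<^bsub>H\<^esub>\<close>] by blast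
      then show ?thesis using W.base_elt_commute[OF mp ab] False by simp
    qed
    finally show ?thesis .
  qed
  have "2 ^ card X \<le> order Q"
  proof (rule Q.order_ge_of_commuting_pairs[OF Q(2), where t = "\<lambda>A. \<phi> (e A a)" and u = "\<lambda>A. \<phi> (e A b)"])
    show "\<phi> (e A a) \<otimes>\<^bsub>Q\<^esub> \<phi> (e B b) = \<phi> (e B b) \<otimes>\<^bsub>Q\<^esub> \<phi> (e A a) \<longleftrightarrow> A \<noteq> B" if "A \<in> X" "B \<in> X" for A B
    proof -
      \<comment> \<open>Injectivity on the ball keeps \<open>Q\<close> from satisfying commutations
        that fail in \<open>\<Gamma>\<close>.\<close>
      have "inj_on \<phi> (word_ball \<Gamma> T (12 * n + 2))" using Q(3) by (simp add: local_embedding_def)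
      from inj_on_eq_iff[OF this prods[of A a B b] prods[of B b A a]] that
      have "\<phi> (e A a \<otimes>\<^bsub>\<Gamma>\<^esub> e B b) = \<phi> (e B b \<otimes>\<^bsub>\<Gamma>\<^esub> e A a) \<longleftrightarrow> A \<noteq> B"
        using comm by simp
      then show ?thesis using \<phi> that by simp
    qed
  qed (use Q(3) big in \<open>auto simp: X_def local_embedding_def\<close>)
  moreover have "card X = 2 ^ card (D \<inter> {0..<int n})"
    unfolding X_def by (rule card_Pow) simp
  ultimately show ?thesis by simp
qed

end

section \<open>Order of the finite wreath products\<close>

lemma order_double_wreath:
  assumes H: "group H" "finite (carrier H)" and m: "m > 0" and D: "finite D"
  shows "finite (carrier (double_wreath H m D))"
    and "order (double_wreath H m D) \<le>
      card (carrier H) ^ (m * card (carrier H) ^ card D) * (card (carrier H) ^ m * m)"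
proof -
  interpret lamps H m D by (rule lamps.intro[OF H(1)])
  let ?q = "card (carrier H)"
  have cyc: "carrier (cyc m) = {0..<int m}" using m by (simp add: carrier_integer_mod_group)
  have q: "?q \<ge> 1" using H(2) H.one_closed by (metis One_nat_def Suc_leI card_gt_0_iff empty_iff)
  have finL: "finite (carrier (lamplighter H m))"
    using H(2) by (simp add: L.carrier_W cyc finite_supported)
  have cardL: "card (carrier (lamplighter H m)) = ?q ^ m * m"
    by (simp add: L.carrier_W cyc card_supported card_cartesian_product)
  have finP: "finite (points H m D)" using finL by (simp add: points_def)
  \<comment> \<open>A representative with second component \<open>p\<close> has its lamps at
    positions that lie in \<open>D\<close> relative to \<open>p\<close>, and there are at most
    \<open>card D\<close> of these. This bounds the number of points by
    \<open>m * ?q ^ card D\<close>.\<close>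
  let ?J = "\<lambda>p. {i \<in> {0..<int m}. (i - p) mod int m \<in> D}"
  have J: "card (?J p) \<le> card D" for p
  proof (rule card_inj_on_le)
    show "inj_on (\<lambda>i. (i - p) mod int m) (?J p)"
    proof (rule inj_onI)
      fix i j assume *: "i \<in> ?J p" "j \<in> ?J p" "(i - p) mod int m = (j - p) mod int m"
      then have "int m dvd (i - p) - (j - p)" by (simp only: mod_eq_dvd_iff)
      then have "i mod int m = j mod int m" by (simp add: mod_eq_dvd_iff)
      with * show "i = j" by simp
    qed
  qed (use D in auto)
  have finJ: "finite (?J p)" for p by (rule finite_subset[of _ "{0..<int m}"]) auto
  have finS: "finite (supported H (?J p))" for p
    using H(2) finJ by (intro finite_supported) auto
  have cardS: "card (supported H (?J p)) = ?q ^ card (?J p)" for p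
    using finJ by (intro card_supported) auto
  \<comment> \<open>Pairs are swapped so that the position indexes the family of lamp
    configurations.\<close>
  have "points H m D \<subseteq> (\<lambda>(p, A). (A, p)) ` (SIGMA p:{0..<int m}. supported H (?J p))"
  proof
    fix x assume x: "x \<in> points H m D"
    obtain A p where eq: "x = (A, p)" by (cases x)
    have "A \<in> supported H {0..<int m}" "p \<in> {0..<int m}"
      "\<And>i. (if (i - p) mod int m \<in> D then A i else \<one>\<^bsub>H\<^esub>) = A i"
      using x by (auto simp: eq points_def L.carrier_W cyc project_def fun_eq_iff)
    then have "(p, A) \<in> (SIGMA p:{0..<int m}. supported H (?J p))"
      unfolding supported_def by (simp, metis)
    then show "x \<in> (\<lambda>(p, A). (A, p)) ` (SIGMA p:{0..<int m}. supported H (?J p))"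
      by (force simp: eq)
  qed
  then have "card (points H m D) \<le> card (SIGMA p:{0..<int m}. supported H (?J p))"
    by (rule surj_card_le[rotated]) (rule finite_SigmaI[OF finite_atLeastLessThan_int finS])
  also have "\<dots> = (\<Sum>p\<in>{0..<int m}. ?q ^ card (?J p))"
    using finS by (subst card_SigmaI) (auto simp only: cardS finite_atLeastLessThan_int)
  also have "\<dots> \<le> (\<Sum>p\<in>{0..<int m}. ?q ^ card D)"
    using q J by (intro sum_mono power_increasing) auto
  finally have P: "card (points H m D) \<le> m * ?q ^ card D" by simp
  show "finite (carrier (double_wreath H m D))"
    using finP finL H(2) by (simp add: W.carrier_W finite_supported)
  have "order (double_wreath H m D) = ?q ^ card (points H m D) * (?q ^ m * m)"
    using finP by (simp add: order_def W.carrier_W card_supported card_cartesian_product cardL)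
  also have "\<dots> \<le> ?q ^ (m * ?q ^ card D) * (?q ^ m * m)"
    using P q by (intro mult_le_mono1 power_increasing) auto
  finally show "order (double_wreath H m D) \<le> ?q ^ (m * ?q ^ card D) * (?q ^ m * m)" .
qed

section \<open>The finitely generated group and its finite models\<close>

lemma local_embedding_nat_copy:
  assumes "group Q'" "finite (carrier Q')" "local_embedding G Q' F \<phi>"
  obtains Q :: "nat monoid" and \<psi>
  where "group Q" "finite (carrier Q)" "order Q = order Q'" "local_embedding G Q F \<psi>"
proof -
  interpret Q': group Q' by fact
  obtain Q :: "nat monoid" and d where Q: "group Q" "d \<in> iso Q Q'"
    using Q'.countable_group_nat_copy countable_finite[OF assms(2)] by blast
  then have bij: "bij_betw d (carrier Q) (carrier Q')" by (simp add: iso_def)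
  have "inv_into (carrier Q) d \<in> iso Q' Q" using group.iso_set_sym[OF Q] .
  then have "local_embedding Q' Q (carrier Q') (inv_into (carrier Q) d)"
    by (intro local_embedding_hom) (auto simp: iso_def bij_betw_def)
  from local_embedding_comp[OF assms(3) this]
  have "local_embedding G Q F (inv_into (carrier Q) d \<circ> \<phi>)"
    using assms(3) by (simp add: local_embedding_def)
  then show thesis
    using that Q(1) bij_betw_finite[OF bij] bij_betw_same_card[OF bij] assms(2) by (simp add: order_def)
qed

text \<open>The double wreath product over the integers is uncountable, so \<open>\<Gamma>\<close>
  is a copy on the naturals of the subgroup generated by \<open>double_gens\<close>. The last two
  conclusions are the two halves of the growth estimate, with \<open>D\<close> entering through its
  counting function alone.\<close>

lemma exists_double_wreath_subgroup:
  fixes H :: "('h, 'm) monoid_scheme"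
  assumes H: "group H" "finite (carrier H)" and D: "D \<subseteq> {0..}"
    and ab: "a \<in> carrier H" "b \<in> carrier H"
    and nc: "a \<otimes>\<^bsub>H\<^esub> b \<noteq> b \<otimes>\<^bsub>H\<^esub> a"
  obtains \<Gamma> :: "nat monoid" and T where "group \<Gamma>" "finite_generating_set \<Gamma> T"
    "\<And>n. \<exists>(Q :: nat monoid) \<phi>. group Q \<and> finite (carrier Q) \<and>
      local_embedding \<Gamma> Q (word_ball \<Gamma> T n) \<phi> \<and>
      order Q \<le> card (carrier H) ^ ((8 * n + 1) * card (carrier H) ^ card (D \<inter> {0..4 * int n})) *
        (card (carrier H) ^ (8 * n + 1) * (8 * n + 1))"
    "\<And>n (Q :: nat monoid) \<phi>. group Q \<Longrightarrow> finite (carrier Q) \<Longrightarrow>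
      local_embedding \<Gamma> Q (word_ball \<Gamma> T (12 * n + 2)) \<phi> \<Longrightarrow>
      2 ^ 2 ^ card (D \<inter> {0..<int n}) \<le> order Q"
proof -
  interpret double_wreath_0 H D a b
    by (rule double_wreath_0.intro[OF H(1) ab])
  define K where "K = generate DW gens"
  have K: "subgroup K DW" unfolding K_def using gens_closed by (rule W.W.generate_is_subgroup)
  interpret K: group "DW\<lparr>carrier := K\<rparr>" using K by (rule W.W.subgroup_imp_group)
  have "countable (carrier (DW\<lparr>carrier := K\<rparr>))"
    using W.W.countable_generate[OF gens_closed] by (simp add: K_def double_gens_def)
  then obtain \<Gamma> :: "nat monoid" and d where \<Gamma>: "group \<Gamma>" "d \<in> iso \<Gamma> (DW\<lparr>carrier := K\<rparr>)"
    using K.countable_group_nat_copy by blast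
  have bij: "bij_betw d (carrier \<Gamma>) K" and hom: "d \<in> hom \<Gamma> DW"
    using \<Gamma>(2) subgroup.subset[OF K] by (auto simp: iso_def hom_def)
  then have inj: "inj_on d (carrier \<Gamma>)" and img: "d ` carrier \<Gamma> = K" by (auto simp: bij_betw_def)
  interpret d: group_hom \<Gamma> DW d
    by (rule group_hom.intro[OF \<Gamma>(1) W.W.group_axioms]) (simp add: group_hom_axioms_def hom)
  define T where "T = {g \<in> carrier \<Gamma>. d g \<in> gens}"
  have gensK: "gens \<subseteq> K" by (auto simp: K_def intro: generate.incl)
  have T: "T \<subseteq> carrier \<Gamma>" "d ` T = gens"
    using gensK img by (auto simp: T_def)
  have "finite T"
    using finite_imageD[of d T] inj_on_subset[OF inj T(1)] T(2) by (simp add: double_gens_def)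
  moreover have "generate \<Gamma> T = carrier \<Gamma>"
  proof
    show "generate \<Gamma> T \<subseteq> carrier \<Gamma>" using d.G.generate_incl[OF T(1)] .
    show "carrier \<Gamma> \<subseteq> generate \<Gamma> T"
    proof
      fix g assume g: "g \<in> carrier \<Gamma>"
      then have "d g \<in> generate DW gens" using img by (auto simp: K_def)
      then obtain n where "d g \<in> word_ball DW gens n" by (rule W.W.generate_in_word_ball)
      then have "d g \<in> d ` word_ball \<Gamma> T n" using d.word_ball_image[OF T(1)] T(2) by simp
      then obtain g' where g': "g' \<in> word_ball \<Gamma> T n" "d g = d g'" by blast
      then have "g = g'"
        using inj g d.G.word_ball_subset_carrier[OF T(1), of n] by (auto dest: inj_onD)
      then show "g \<in> generate \<Gamma> T" using g' by (simp add: word_ball_def)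
    qed
  qed
  ultimately have gen: "finite_generating_set \<Gamma> T" using T(1) by (simp add: finite_generating_set_def)
  have upper: "\<exists>(Q :: nat monoid) \<phi>. group Q \<and> finite (carrier Q) \<and>
      local_embedding \<Gamma> Q (word_ball \<Gamma> T n) \<phi> \<and>
      order Q \<le> card (carrier H) ^ ((8 * n + 1) * card (carrier H) ^ card (D \<inter> {0..4 * int n})) *
        (card (carrier H) ^ (8 * n + 1) * (8 * n + 1))" for n
  proof -
    \<comment> \<open>Truncation at \<open>4 * n\<close> and the modulus \<open>8 * n + 1\<close>,
      the least one above \<open>8 * n\<close>, are what \<open>project_reduce\<close> calls
      for.\<close>
    define D' where "D' = D \<inter> {0..4 * int n}"
    interpret fin: lamps H "8 * n + 1" D' by (rule lamps.intro[OF H(1)])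
    obtain \<phi> where \<phi>: "local_embedding DW (double_wreath H (8 * n + 1) D') (dw_ball H D n) \<phi>"
      using local_embedding_double_wreath[OF H(1) _ D, of n "8 * n + 1"] unfolding D'_def by auto
    have "local_embedding \<Gamma> DW (word_ball \<Gamma> T n) d"
      using local_embedding_hom[OF hom inj d.G.word_ball_subset_carrier[OF T(1)]] .
    moreover have "d ` word_ball \<Gamma> T n \<subseteq> dw_ball H D n"
      using d.word_ball_image[OF T(1)] T(2) word_ball_subset_dw_ball by simp
    ultimately have "local_embedding \<Gamma> (double_wreath H (8 * n + 1) D') (word_ball \<Gamma> T n) (\<phi> \<circ> d)"
      using local_embedding_comp[OF _ \<phi>] by blast
    note nat_copy = local_embedding_nat_copy[OF fin.W.group_W _ this]
    have "finite D'" by (simp add: D'_def)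
    note order = order_double_wreath[OF H _ this, of "8 * n + 1"]
    obtain Q :: "nat monoid" and \<psi> where "group Q" "finite (carrier Q)"
      "order Q = order (double_wreath H (8 * n + 1) D')" "local_embedding \<Gamma> Q (word_ball \<Gamma> T n) \<psi>"
      using nat_copy order(1) by (metis add_gr_0 zero_less_one)
    with order(2) show ?thesis unfolding D'_def by auto
  qed
  show thesis
    using that[OF \<Gamma>(1) gen upper order_lower_bound[OF d.group_hom_axioms inj T _ _ _ nc]] .
qed

section \<open>LEF growth as an attained minimum\<close>

lemma LEF_growth_le:
  fixes Q :: "nat monoid"
  assumes "group Q" "finite (carrier Q)" "local_embedding G Q (word_ball G S n) \<phi>"
  shows "LEF_growth G S n \<le> order Q"
  unfolding LEF_growth_def using assms by (intro Least_le) blast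

text \<open>\<open>LEAST\<close> carries information only if some candidate exists;
  \<open>Q'\<close> is that candidate.\<close>

lemma LEF_growth_attained:
  fixes Q' :: "nat monoid"
  assumes "group Q'" "finite (carrier Q')" "local_embedding G Q' (word_ball G S n) \<psi>"
  obtains Q :: "nat monoid" and \<phi> where "group Q" "finite (carrier Q)"
    "order Q = LEF_growth G S n" "local_embedding G Q (word_ball G S n) \<phi>"
proof -
  have "\<exists>q (Q :: nat monoid) \<phi>. group Q \<and> finite (carrier Q) \<and> order Q = q \<and>
      local_embedding G Q (word_ball G S n) \<phi>"
    using assms by blast
  from LeastI_ex[OF this] show thesis
    using that unfolding LEF_growth_def by blast
qed

lemma (in group) finite_subset_word_ball:
  assumes T: "finite_generating_set G T" and F: "finite F" "F \<subseteq> carrier G"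
  obtains n where "F \<subseteq> word_ball G T n"
proof -
  have "\<exists>n. F \<subseteq> word_ball G T n"
    using F
  proof (induction F)
    case (insert x F)
    then obtain n where n: "F \<subseteq> word_ball G T n" by auto
    obtain k where "x \<in> word_ball G T k"
      using insert.prems T generate_in_word_ball[of x T] by (auto simp: finite_generating_set_def)
    then show ?case
      using n word_ball_mono[of n "max n k" G T] word_ball_mono[of k "max n k" G T]
      by (intro exI[of _ "max n k"]) auto
  qed simp
  then show thesis using that by blast
qed

section \<open>Growth estimates\<close>

text \<open>The summand \<open>j\<close> makes the enumeration strictly increasing.\<close>

definition sparse_set :: "real \<Rightarrow> int set" where
  "sparse_set r = range (\<lambda>j :: nat. int j + \<lfloor>exp (real j powr (1 / r))\<rfloor>)"

lemma sparse_set_nonneg: "sparse_set r \<subseteq> {0..}"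
  by (auto simp: sparse_set_def)

text \<open>If the element with index \<open>j\<close> is at most \<open>n\<close>, then
  \<open>exp (j powr (1 / r)) < n + 1\<close>, so \<open>j < ln (n + 1) powr r\<close>. The inner
  \<open>+ 1\<close> pays for the floor, the final one for rounding up the number of
  indices.\<close>

lemma card_sparse_set_le:
  assumes r: "0 < r" and n: "1 \<le> n"
  shows "real (card (sparse_set r \<inter> {0..int n})) \<le> ln (real n + 1) powr r + 1"
proof -
  define x where "x = ln (real n + 1) powr r"
  have x: "x > 0" using n by (simp add: x_def)
  have "sparse_set r \<inter> {0..int n} \<subseteq> (\<lambda>j. int j + \<lfloor>exp (real j powr (1 / r))\<rfloor>) ` {..<nat \<lceil>x\<rceil>}"
  proof (rule subsetI)
    fix d assume "d \<in> sparse_set r \<inter> {0..int n}"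
    then obtain j where j: "d = int j + \<lfloor>exp (real j powr (1 / r))\<rfloor>" "d \<le> int n"
      by (auto simp: sparse_set_def)
    then have "\<lfloor>exp (real j powr (1 / r))\<rfloor> \<le> int n" by linarith
    then have "exp (real j powr (1 / r)) < real n + 1" by linarith
    then have "ln (exp (real j powr (1 / r))) < ln (real n + 1)"
      by (subst ln_less_cancel_iff) (auto simp: add_pos_nonneg)
    then have "real j powr (1 / r) < ln (real n + 1)" by simp
    then have "(real j powr (1 / r)) powr r < x" unfolding x_def using r by (intro powr_less_mono2) auto
    then have "real j < x" using r x by (simp add: powr_powr)
    then have "j < nat \<lceil>x\<rceil>" by linarith
    then show "d \<in> (\<lambda>j. int j + \<lfloor>exp (real j powr (1 / r))\<rfloor>) ` {..<nat \<lceil>x\<rceil>}" using j by blast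
  qed
  then have "card (sparse_set r \<inter> {0..int n}) \<le> nat \<lceil>x\<rceil>"
    using surj_card_le[OF finite_lessThan] by fastforce
  then show ?thesis unfolding x_def[symmetric] using x by linarith
qed

text \<open>Take for \<open>n\<close> the element with index \<open>J\<close>: the \<open>J\<close>
  earlier ones lie below it by strict monotonicity.\<close>

lemma card_sparse_set_ge:
  assumes r: "0 < r"
  obtains n :: nat where "J \<le> card (sparse_set r \<inter> {0..<int n})"
    "real n \<le> real J + exp (real J powr (1 / r)) + 1"
proof -
  define d where "d j = int j + \<lfloor>exp (real j powr (1 / r))\<rfloor>" for j :: nat
  have mono: "d i < d j" if "i < j" for i j
  proof -
    have "exp (real i powr (1 / r)) \<le> exp (real j powr (1 / r))"
      using that r by (simp add: powr_mono2)
    then have "\<lfloor>exp (real i powr (1 / r))\<rfloor> \<le> \<lfloor>exp (real j powr (1 / r))\<rfloor>" by (rule floor_mono)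
    then show ?thesis using that by (simp add: d_def)
  qed
  have "inj_on d {..<J}"
    by (rule inj_onI) (metis mono less_irrefl linorder_neqE_nat)
  moreover have "d ` {..<J} \<subseteq> sparse_set r \<inter> {0..<int (nat (d J))}"
  proof (rule image_subsetI)
    fix j assume "j \<in> {..<J}"
    then have "0 \<le> d j" "d j < d J" using mono by (auto simp: d_def)
    then show "d j \<in> sparse_set r \<inter> {0..<int (nat (d J))}"
      by (auto simp: sparse_set_def d_def)
  qed
  ultimately have "J \<le> card (sparse_set r \<inter> {0..<int (nat (d J))})"
    by (metis card_image card_lessThan card_mono finite_Int finite_atLeastLessThan_int)
  moreover have "real (nat (d J)) \<le> real J + exp (real J powr (1 / r)) + 1"
  proof -
    have "real (nat (d J)) = real J + real_of_int \<lfloor>exp (real J powr (1 / r))\<rfloor>"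
      by (simp add: d_def of_nat_nat)
    also have "\<dots> \<le> real J + exp (real J powr (1 / r)) + 1" by linarith
    finally show ?thesis .
  qed
  ultimately show thesis using that by blast
qed

text \<open>With \<open>L = ln (500 * n)\<close>, the bound \<open>6 \<le> exp 2\<close> gives
  \<open>6 ^ c \<le> 9 * exp (2 * L powr r)\<close>. The other factor of the exponent is at most
  \<open>45 * n\<close>, and \<open>45 * 9 * n \<le> 500 * n = exp L \<le> exp (L powr r)\<close>;
  together this makes the factor 3.\<close>

lemma upper_bound_estimate:
  fixes r :: real
  assumes r: "1 \<le> r" and n: "1 \<le> n" and c: "real c \<le> ln (real (4 * n) + 1) powr r + 1"
  shows "real (6 ^ ((8 * n + 1) * 6 ^ c) * (6 ^ (8 * n + 1) * (8 * n + 1)))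
    \<le> exp (exp (3 * ln (real (500 * n)) powr r))"
proof -
  define m where "m = 8 * n + 1"
  have e2: "6 \<le> exp (2 :: real)" "exp (2 :: real) \<le> 9"
  proof -
    \<comment> \<open>\<open>13 / 8 = 1 + 1 / 2 + 1 / 8\<close> is the quadratic Taylor bound for
      \<open>exp (1 / 2)\<close>; its fourth power exceeds 6.\<close>
    have "(13 / 8) ^ 4 \<le> exp (1 / 2 :: real) ^ 4"
      using exp_lower_Taylor_quadratic[of "1 / 2 :: real"] by (intro power_mono) (auto simp: power2_eq_square)
    also have "\<dots> = exp (2 :: real)" by (simp flip: exp_of_nat_mult)
    finally show "6 \<le> exp (2 :: real)" by (simp add: eval_nat_numeral)
    have "exp (2 :: real) = exp 1 ^ 2" by (simp flip: exp_of_nat_mult)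
    also have "\<dots> \<le> 3 ^ 2" using exp_le by (intro power_mono) auto
    finally show "exp (2 :: real) \<le> 9" by simp
  qed
  have six: "(6 :: real) ^ k \<le> exp (2 * real k)" for k
    using power_mono[OF e2(1), of k] by (simp add: exp_of_nat_mult mult.commute)
  have L: "1 \<le> ln (real (500 * n))"
    using n exp_le by (subst ln_ge_iff) auto
  have "real m \<le> exp (real m)" using exp_ge_add_one_self[of "real m"] by linarith
  then have "real (6 ^ (m * 6 ^ c) * (6 ^ m * m)) \<le>
      exp (2 * real (m * 6 ^ c)) * (exp (2 * real m) * exp (real m))"
    using six[of "m * 6 ^ c"] six[of m] by (simp add: mult_mono)
  also have "\<dots> = exp (2 * real (m * 6 ^ c) + 3 * real m)"
    by (simp flip: exp_add)
  also have "\<dots> \<le> exp (5 * real m * 6 ^ c)" (is "_ \<le> exp ?E")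
    using mult_left_mono[OF one_le_power[of "6 :: real" c], of "real m"] by simp
  finally have order: "real (6 ^ (m * 6 ^ c) * (6 ^ m * m)) \<le> exp ?E" .
  have "?E \<le> 45 * real n * (exp (2 * ln (real (500 * n)) powr r) * 9)"
  proof (rule mult_mono)
    show "5 * real m \<le> 45 * real n" using n by (simp add: m_def)
    have "ln (real (4 * n) + 1) powr r \<le> ln (real (500 * n)) powr r"
      using n r by (intro powr_mono2) auto
    then have "exp (2 * real c) \<le> exp (2 * ln (real (500 * n)) powr r + 2)"
      using c by simp
    also have "\<dots> \<le> exp (2 * ln (real (500 * n)) powr r) * 9"
      using e2 by (simp add: exp_add)
    finally show "6 ^ c \<le> exp (2 * ln (real (500 * n)) powr r) * 9" using six[of c] by linarith
  qed auto
  also have "\<dots> \<le> real (500 * n) * exp (2 * ln (real (500 * n)) powr r)"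
    by simp
  also have "\<dots> \<le> exp (ln (real (500 * n)) powr r) * exp (2 * ln (real (500 * n)) powr r)"
  proof (rule mult_right_mono)
    have "ln (real (500 * n)) powr 1 \<le> ln (real (500 * n)) powr r"
      using L r by (intro powr_mono) auto
    then have "exp (ln (real (500 * n))) \<le> exp (ln (real (500 * n)) powr r)" using L by simp
    then show "real (500 * n) \<le> exp (ln (real (500 * n)) powr r)" using n by simp
  qed simp
  also have "\<dots> = exp (3 * ln (real (500 * n)) powr r)" by (simp flip: exp_add)
  finally have "exp ?E \<le> exp (exp (3 * ln (real (500 * n)) powr r))" by simp
  with order show ?thesis unfolding m_def by (rule order_trans)
qed


text \<open>Put \<open>y = J powr (1 / r)\<close>. The argument of \<open>ln\<close> grows like
  \<open>exp y\<close>, hence is eventually below \<open>exp (2 * y)\<close>, and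
  \<open>C * (2 * y) powr r'\<close> falls behind \<open>ln 2 * y powr r = ln 2 * J\<close> because
  \<open>r' < r\<close>.\<close>

lemma lower_bound_estimate:
  fixes r r' C K :: real
  assumes r: "0 \<le> r'" "r' < r" and C: "C > 0" and K: "K > 0"
  obtains J :: nat where
    "exp (exp (C * ln (K * (12 * (real J + exp (real J powr (1 / r)) + 1) + 2)) powr r')) < 2 ^ 2 ^ J"
proof -
  have lim: "filterlim (\<lambda>J::nat. real J powr (1 / r)) at_top sequentially"
    using r by real_asymp
  have 1: "eventually (\<lambda>y::real. K * (12 * (y powr r + exp y + 1) + 2) \<le> exp (2 * y)) at_top"
    using r K by real_asymp
  have 2: "eventually (\<lambda>y::real. C * (2 * y) powr r' < ln 2 * y powr r - 1) at_top"
    using r C by real_asymp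
  \<comment> \<open>Keeps the logarithm nonnegative, as monotonicity of \<open>powr\<close>
    requires.\<close>
  have 3: "eventually (\<lambda>y::real. 1 \<le> K * (12 * (y powr r + exp y + 1) + 2)) at_top"
    using r K by real_asymp
  have "eventually (\<lambda>J::nat. K * (12 * ((real J powr (1 / r)) powr r + exp (real J powr (1 / r)) + 1) + 2)
      \<le> exp (2 * real J powr (1 / r)) \<and>
      C * (2 * real J powr (1 / r)) powr r' < ln 2 * (real J powr (1 / r)) powr r - 1 \<and>
      1 \<le> K * (12 * ((real J powr (1 / r)) powr r + exp (real J powr (1 / r)) + 1) + 2)) sequentially"
    using eventually_compose_filterlim[OF eventually_conj[OF 1 eventually_conj[OF 2 3]] lim] .
  then obtain J :: nat where J: "K * (12 * ((real J powr (1 / r)) powr r + exp (real J powr (1 / r)) + 1) + 2)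
      \<le> exp (2 * real J powr (1 / r))"
      "C * (2 * real J powr (1 / r)) powr r' < ln 2 * (real J powr (1 / r)) powr r - 1"
      "1 \<le> K * (12 * ((real J powr (1 / r)) powr r + exp (real J powr (1 / r)) + 1) + 2)"
    using eventually_happens'[OF sequentially_bot] by blast
  have yr: "(real J powr (1 / r)) powr r = real J" using r by (simp add: powr_powr)
  define N where "N = K * (12 * (real J + exp (real J powr (1 / r)) + 1) + 2)"
  have "1 \<le> N" using J(3) unfolding yr N_def .
  moreover have "ln N \<le> ln (exp (2 * real J powr (1 / r)))"
    using J(1) \<open>1 \<le> N\<close> unfolding yr N_def[symmetric] by (subst ln_le_cancel_iff) auto
  ultimately have "C * ln N powr r' \<le> C * (2 * real J powr (1 / r)) powr r'"
    using r C by (intro mult_left_mono powr_mono2) auto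
  also have "\<dots> < ln 2 * real J - 1" using J(2) unfolding yr .
  finally have "exp (C * ln N powr r') < exp (ln 2 * real J - 1)" by simp
  \<comment> \<open>The spare \<open>- 1\<close> in the exponent absorbs the outer logarithm:
    \<open>exp (- 1) \<le> 1 / 2 \<le> ln 2\<close>, and \<open>2 ^ J * ln 2\<close> is the
    logarithm of \<open>2 ^ 2 ^ J\<close>.\<close>
  also have "\<dots> = 2 ^ J * exp (- 1)"
    by (simp add: exp_diff exp_minus divide_inverse exp_of_nat2_mult)
  also have "\<dots> \<le> 2 ^ J * ln 2"
  proof -
    have "exp (- 1) \<le> (1 / 2 :: real)"
      using exp_ge_add_one_self[of "1 :: real"] by (simp add: exp_minus field_simps)
    also have "\<dots> \<le> ln 2" using ln_le_minus_one[of "1 / 2 :: real"] by (simp add: ln_div)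
    finally show ?thesis by simp
  qed
  also have "\<dots> = ln (2 ^ 2 ^ J)" by (simp add: ln_realpow)
  finally have "exp (exp (C * ln N powr r')) < exp (ln (2 ^ 2 ^ J))" by (simp only: exp_less_cancel_iff)
  then have "exp (exp (C * ln N powr r')) < 2 ^ 2 ^ J" by simp
  then show thesis using that unfolding N_def by blast
qed

section \<open>Lamps in the symmetric group on three points; bounds for arbitrary generating
  sets\<close>

theorem theorem1p5:
  fixes r :: real
  assumes "2 \<le> r"
  shows "\<exists>\<Gamma> :: nat monoid. group \<Gamma> \<and> finitely_generated \<Gamma> \<and> LEF \<Gamma> \<and>
    (\<exists>C\<^sub>r::real. C\<^sub>r > 0 \<and>
       (\<forall>S. finite_generating_set \<Gamma> S \<longrightarrow>
          (\<lambda>n. real (LEF_growth \<Gamma> S n)) \<preceq>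
          (\<lambda>n. exp (exp (C\<^sub>r * (ln (real n)) powr r))))) \<and>
    (\<forall>r' C :: real. 2 \<le> r' \<and> r' < r \<and> C > 0 \<longrightarrow>
       (\<forall>S. finite_generating_set \<Gamma> S \<longrightarrow>
          \<not> (\<lambda>n. real (LEF_growth \<Gamma> S n)) \<preceq>
            (\<lambda>n. exp (exp (C * (ln (real n)) powr r')))))"
proof -
  let ?H = "sym_group 3"
  have a: "transpose 1 2 \<in> carrier ?H" and b: "transpose 2 3 \<in> carrier ?H"
    by (auto simp: sym_group_carrier intro!: permutes_swap_id)
  have nc: "transpose 1 2 \<otimes>\<^bsub>?H\<^esub> transpose 2 3 \<noteq> transpose 2 3 \<otimes>\<^bsub>?H\<^esub> transpose 1 2"
  proof
    assume "transpose 1 2 \<otimes>\<^bsub>?H\<^esub> transpose 2 3 = transpose 2 3 \<otimes>\<^bsub>?H\<^esub> transpose 1 2"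
    from fun_cong[OF this, of 1] show False by (simp add: sym_group_mult transpose_def)
  qed
  have card_H: "card (carrier ?H) = 6" by (simp add: sym_group_card_carrier fact_numeral)
  then have fin_H: "finite (carrier ?H)" by (simp add: card_ge_0_finite)
  obtain \<Gamma> :: "nat monoid" and T where \<Gamma>: "group \<Gamma>" and T: "finite_generating_set \<Gamma> T"
    and upper: "\<And>n. \<exists>(Q :: nat monoid) \<phi>. group Q \<and> finite (carrier Q) \<and>
      local_embedding \<Gamma> Q (word_ball \<Gamma> T n) \<phi> \<and>
      order Q \<le> 6 ^ ((8 * n + 1) * 6 ^ card (sparse_set r \<inter> {0..4 * int n})) * (6 ^ (8 * n + 1) * (8 * n + 1))"
    and lower: "\<And>n (Q :: nat monoid) \<phi>. group Q \<Longrightarrow> finite (carrier Q) \<Longrightarrow>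
      local_embedding \<Gamma> Q (word_ball \<Gamma> T (12 * n + 2)) \<phi> \<Longrightarrow>
      2 ^ 2 ^ card (sparse_set r \<inter> {0..<int n}) \<le> order Q"
    using exists_double_wreath_subgroup[OF sym_group_is_group fin_H sparse_set_nonneg[of r] a b nc]
    unfolding card_H by blast
  interpret group \<Gamma> by fact
  have "LEF \<Gamma>"
    unfolding LEF_def
  proof (intro allI impI)
    fix F assume "finite F \<and> F \<subseteq> carrier \<Gamma>"
    then obtain n where "F \<subseteq> word_ball \<Gamma> T n" using finite_subset_word_ball[OF T] by blast
    then show "\<exists>(Q :: nat monoid) \<phi>. group Q \<and> finite (carrier Q) \<and> local_embedding \<Gamma> Q F \<phi>"
      using upper[of n] local_embedding_subset by blast
  qed
  moreover have "(\<lambda>n. real (LEF_growth \<Gamma> S n)) \<preceq> (\<lambda>n. exp (exp (3 * ln (real n) powr r)))"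
    if S: "finite_generating_set \<Gamma> S" for S
  proof -
    obtain K where K: "K > 0" "\<And>n. word_ball \<Gamma> S n \<subseteq> word_ball \<Gamma> T (K * n)"
      using word_ball_change[OF S T] by blast
    \<comment> \<open>\<open>K\<close> comes from the change of generators and 500 from
      \<open>upper_bound_estimate\<close>; both go into the constant of
      \<open>growth_le\<close>.\<close>
    have "real (LEF_growth \<Gamma> S n) \<le> exp (exp (3 * ln (real (500 * K * n)) powr r))" if "n \<ge> 1" for n
    proof -
      define c where "c = card (sparse_set r \<inter> {0..4 * int (K * n)})"
      have c: "real c \<le> ln (real (4 * (K * n)) + 1) powr r + 1"
        using card_sparse_set_le[of r "4 * (K * n)"] assms K(1) that by (simp add: c_def)
      obtain Q :: "nat monoid" and \<phi> where Q: "group Q" "finite (carrier Q)"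
        "local_embedding \<Gamma> Q (word_ball \<Gamma> T (K * n)) \<phi>"
        "order Q \<le> 6 ^ ((8 * (K * n) + 1) * 6 ^ c) * (6 ^ (8 * (K * n) + 1) * (8 * (K * n) + 1))"
        using upper[of "K * n"] unfolding c_def by blast
      have "LEF_growth \<Gamma> S n \<le> order Q"
        using LEF_growth_le[OF Q(1,2) local_embedding_subset[OF Q(3) K(2)]] .
      then have "real (LEF_growth \<Gamma> S n) \<le>
          real (6 ^ ((8 * (K * n) + 1) * 6 ^ c) * (6 ^ (8 * (K * n) + 1) * (8 * (K * n) + 1)))"
        using Q(4) by (simp only: of_nat_le_iff)
      also have "\<dots> \<le> exp (exp (3 * ln (real (500 * (K * n))) powr r))"
        using upper_bound_estimate[OF _ _ c] assms K(1) that by simp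
      finally show ?thesis by (simp add: mult.assoc)
    qed
    then show ?thesis
      unfolding growth_le_def using K(1) by (intro exI[of _ "500 * K"]) simp
  qed
  moreover have "\<not> (\<lambda>n. real (LEF_growth \<Gamma> S n)) \<preceq> (\<lambda>n. exp (exp (C * ln (real n) powr r')))"
    if r': "2 \<le> r'" "r' < r" and C: "C > 0" and S: "finite_generating_set \<Gamma> S" for r' C S
  proof
    assume "(\<lambda>n. real (LEF_growth \<Gamma> S n)) \<preceq> (\<lambda>n. exp (exp (C * ln (real n) powr r')))"
    then obtain c :: nat where c: "c > 0"
      "\<And>n. n \<ge> 1 \<Longrightarrow> real (LEF_growth \<Gamma> S n) \<le> exp (exp (C * ln (real (c * n)) powr r'))"
      unfolding growth_le_def by blast
    obtain K where K: "K > 0" "\<And>n. word_ball \<Gamma> T n \<subseteq> word_ball \<Gamma> S (K * n)"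
      using word_ball_change[OF T S] by blast
    \<comment> \<open>This inclusion provides a finite group for the balls of \<open>S\<close>, so
      that their \<open>LEF_growth\<close> is attained.\<close>
    obtain K' where K': "\<And>n. word_ball \<Gamma> S n \<subseteq> word_ball \<Gamma> T (K' * n)"
      using word_ball_change[OF S T] by blast
    \<comment> \<open>\<open>J\<close> is chosen first, against the constant \<open>c * K\<close>.
      Then \<open>n\<close> is found from \<open>J\<close> and bounded in terms of it, so that
      \<open>c * N\<close> below stays under the argument of \<open>ln\<close> here.\<close>
    obtain J :: nat where J: "exp (exp (C * ln (real (c * K) * (12 * (real J + exp (real J powr (1 / r)) + 1) + 2))
        powr r')) < 2 ^ 2 ^ J"
      using lower_bound_estimate[of r' r C "real (c * K)"] r' C c(1) K(1) by auto
    obtain n where n: "J \<le> card (sparse_set r \<inter> {0..<int n})"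
      "real n \<le> real J + exp (real J powr (1 / r)) + 1"
      using card_sparse_set_ge[of r J] assms by auto
    \<comment> \<open>The ball of radius \<open>N\<close> for \<open>S\<close> contains the ball of
      radius \<open>12 * n + 2\<close> for \<open>T\<close>, where the lower bound applies.\<close>
    define N where "N = K * (12 * n + 2)"
    have N: "N \<ge> 1" using K(1) by (simp add: N_def)
    obtain Q' :: "nat monoid" and \<psi> where Q': "group Q'" "finite (carrier Q')"
      "local_embedding \<Gamma> Q' (word_ball \<Gamma> T (K' * N)) \<psi>"
      using upper by blast
    obtain Q :: "nat monoid" and \<phi> where Q: "group Q" "finite (carrier Q)"
      "order Q = LEF_growth \<Gamma> S N" "local_embedding \<Gamma> Q (word_ball \<Gamma> S N) \<phi>"
      using LEF_growth_attained[OF Q'(1,2) local_embedding_subset[OF Q'(3) K']] by blast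
    have "2 ^ 2 ^ card (sparse_set r \<inter> {0..<int n}) \<le> order Q"
      using lower[OF Q(1,2) local_embedding_subset[OF Q(4)]] K(2)[of "12 * n + 2"] by (simp add: N_def)
    moreover have "(2 :: nat) ^ 2 ^ J \<le> 2 ^ 2 ^ card (sparse_set r \<inter> {0..<int n})"
      using n(1) by (intro power_increasing) auto
    ultimately have "2 ^ 2 ^ J \<le> LEF_growth \<Gamma> S N"
      using Q(3) by linarith
    then have "2 ^ 2 ^ J \<le> real (LEF_growth \<Gamma> S N)"
      by (metis of_nat_le_iff of_nat_numeral of_nat_power)
    also have "\<dots> \<le> exp (exp (C * ln (real (c * N)) powr r'))"
      using c(2)[OF N] .
    also have "\<dots> \<le> exp (exp (C * ln (real (c * K) * (12 * (real J + exp (real J powr (1 / r)) + 1) + 2)) powr r'))"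
    proof -
      have cN: "real (c * N) = real (c * K) * (12 * real n + 2)" by (simp add: N_def algebra_simps)
      define M where "M = real (c * K) * (12 * (real J + exp (real J powr (1 / r)) + 1) + 2)"
      have "0 < c * N" using c(1) N by simp
      then have "1 \<le> real (c * N)" by linarith
      moreover have "real (c * N) \<le> M"
        unfolding cN M_def using n(2) by (intro mult_left_mono) auto
      ultimately have "0 \<le> ln (real (c * N))" "ln (real (c * N)) \<le> ln M"
        by (simp_all only: ln_ge_zero ln_mono)
      then have "ln (real (c * N)) powr r' \<le> ln M powr r'"
        using r' by (intro powr_mono2) auto
      then have "ln (real (c * N)) powr r' \<le>
          ln (real (c * K) * (12 * (real J + exp (real J powr (1 / r)) + 1) + 2)) powr r'"
        unfolding M_def .
      then show ?thesis using C by simp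
    qed
    also note J
    finally show False by simp
  qed
  moreover have "finitely_generated \<Gamma>" using T by (auto simp: finitely_generated_def)
  ultimately show ?thesis
    using \<Gamma> by (intro exI[of _ \<Gamma>] conjI exI[of _ "3 :: real"] allI impI) auto
qed

end
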